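(* Let $F:(M^m,g_M)\to(N^n,g_N)$ be a totally geodesic Riemannian map between Riemannian manifolds such that the distribution $(range F_\ast)^\bot$ is totally geodesic, and let $(N,g_N,\xi,\lambda)$ be a Ricci soliton with potential vector field $\xi\in\Gamma(range F_\ast)^\bot$. Then the scalar curvature of $range F_\ast$ is $-\lambda(m-r)$, where $\dim(range F_\ast)=m-r$.
   Context: A smooth map $F:(M^m,g_M)\to(N^n,g_N)$ with $0<rank F\le\min\{m,n\}$ is a Riemannian map if at each $p\in M$ the restriction of $F_{\ast p}$ to $(\ker F_{\ast p})^\bot$ is a linear isometry onto $range F_{\ast p}$; $r=\dim\ker F_\ast$. It is totally geodesic if its second fundamental form $(\nabla F_\ast)(X,Y)=\overset{N}{\nabla^F_X}F_\ast Y-F_\ast(\nabla^M_XY)$ vanishes, where $\overset{N}{\nabla^F}$ is the pullback of the Levi-Civita connection $\nabla^N$. $(range F_\ast)^\bot$ is the orthogonal complement of $range F_\ast$ in $TN$; following the paper, both are regarded as complementary orthogonal distributions (subbundles of $TN$) on $N$. The distribution $(range F_\ast)^\bot$ is totally geodesic if $\nabla^N_UV\in\Gamma(range F_\ast)^\bot$ for all $U,V\in\Gamma(range F_\ast)^\bot$. With $R^N(X_1,Y_1)Z_1=\nabla^N_{X_1}\nabla^N_{Y_1}Z_1-\nabla^N_{Y_1}\nabla^N_{X_1}Z_1-\nabla^N_{[X_1,Y_1]}Z_1$ and a local orthonormal frame $\{F_\ast X_j\}_{r+1\le j\le m}$ of $range F_\ast$, put $Ric^{range F_\ast}(F_\ast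 X,F_\ast Y)=\sum_jg_N(R^N(F_\ast X_j,F_\ast X)F_\ast Y,F_\ast X_j)$; the scalar curvature of $range F_\ast$ is $s^{range F_\ast}=\sum_jRic^{range F_\ast}(F_\ast X_j,F_\ast X_j)$. A Riemannian manifold $(N,g_N)$ is a Ricci soliton $(N,g_N,\xi,\lambda)$ if $\xi$ is a smooth vector field on $N$ and $\lambda$ a constant with $\frac12(L_\xi g_N)+Ric+\lambda g_N=0$, where $L_\xi$ is the Lie derivative and $Ric$ the Ricci tensor.
   Formalization: It is additionally assumed that range F_*, regarded as a distribution on N, is totally geodesic at points outside the closure of F(M); otherwise the claim fails, e.g. for the equator in the round sphere minus its poles with range F_* tangent to the parallels and ξ = 0. *)

theory Defs
  imports "HOL-Analysis.Analysis"
begin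

section \<open>Smooth manifolds\<close>

primrec Ck_on :: "nat \<Rightarrow> 'v::real_normed_vector set \<Rightarrow> ('v \<Rightarrow> 'w::real_normed_vector) \<Rightarrow> bool" where
  "Ck_on 0 S f \<longleftrightarrow> continuous_on S f"
| "Ck_on (Suc k) S f \<longleftrightarrow>
     (\<forall>x\<in>S. f differentiable at x) \<and> (\<forall>v. Ck_on k S (\<lambda>x. frechet_derivative f (at x) v))"

text \<open>Only used for open \<open>S\<close> in a finite-dimensional space.\<close>

definition smooth_on :: "'v::real_normed_vector set \<Rightarrow> ('v \<Rightarrow> 'w::real_normed_vector) \<Rightarrow> bool" where
  "smooth_on S f \<longleftrightarrow> (\<forall>k. Ck_on k S f)"

text \<open>
  The underlying set of a manifold is a whole (Hausdorff) type \<open>'a\<close>, its dimension is \<open>DIM('e)\<close>.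
  The atlas is indexed by the points: \<open>coord A p\<close>, defined on \<open>chart_dom A p\<close>, is a chart around \<open>p\<close>.
  Every smooth structure is generated by such an atlas. Second countability is not required.
\<close>

record ('a, 'e) atlas =
  chart_dom :: "'a \<Rightarrow> 'a set"
  coord :: "'a \<Rightarrow> 'a \<Rightarrow> 'e"

definition param :: "('a, 'e) atlas \<Rightarrow> 'a \<Rightarrow> 'e \<Rightarrow> 'a" where
  "param A c = inv_into (chart_dom A c) (coord A c)"

definition smooth_manifold :: "('a::t2_space, 'e::euclidean_space) atlas \<Rightarrow> bool" where
  "smooth_manifold A \<longleftrightarrow>
     (\<forall>c. c \<in> chart_dom A c \<and> open (chart_dom A c) \<and> open (coord A c ` chart_dom A c) \<and>
          homeomorphism (chart_dom A c) (coord A c ` chart_dom A c) (coord A c) (param A c)) \<and>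
     (\<forall>c d. smooth_on (coord A c ` (chart_dom A c \<inter> chart_dom A d)) (coord A d \<circ> param A c))"

definition smooth_fun_on ::
  "('a::t2_space, 'e::euclidean_space) atlas \<Rightarrow> 'a set \<Rightarrow> ('a \<Rightarrow> 'w::real_normed_vector) \<Rightarrow> bool" where
  "smooth_fun_on A W f \<longleftrightarrow> (\<forall>c. smooth_on (coord A c ` (W \<inter> chart_dom A c)) (f \<circ> param A c))"

definition smooth_map :: "('a::t2_space, 'e::euclidean_space) atlas \<Rightarrow>
    ('b::t2_space, 'f::euclidean_space) atlas \<Rightarrow> ('a \<Rightarrow> 'b) \<Rightarrow> bool" where
  "smooth_map M N F \<longleftrightarrow> continuous_on UNIV F \<and>
     (\<forall>d. smooth_fun_on M (F -` chart_dom N d) (coord N d \<circ> F))"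

section \<open>Tangent vectors and vector fields\<close>

text \<open>
  The tangent space at \<open>p\<close> is the model space \<open>'e\<close>: a tangent vector at \<open>p\<close> is given by its
  components in the chart \<open>coord A p\<close>. A vector field is thus a function \<open>'a \<Rightarrow> 'e\<close>, whose values
  at different points refer to different charts; \<open>components A c p v\<close> are the components in the chart
  \<open>coord A c\<close> of a vector \<open>v\<close> tangent at a point \<open>p \<in> chart_dom A c\<close>.
  Vector fields are total functions; only their values on the open set under consideration matter.
\<close>

definition dir_deriv :: "('a::t2_space, 'e::euclidean_space) atlas \<Rightarrow>
    ('a \<Rightarrow> 'w::real_normed_vector) \<Rightarrow> 'a \<Rightarrow> 'e \<Rightarrow> 'w" where
  "dir_deriv A f p v = frechet_derivative (f \<circ> param A p) (at (coord A p p)) v"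

definition components :: "('a::t2_space, 'e::euclidean_space) atlas \<Rightarrow> 'a \<Rightarrow> 'a \<Rightarrow> 'e \<Rightarrow> 'e" where
  "components A c p v = dir_deriv A (coord A c) p v"

text \<open>\<open>coord_field A c v\<close>: the field on \<open>chart_dom A c\<close> with constant components \<open>v\<close> in \<open>coord A c\<close>.\<close>

definition coord_field :: "('a::t2_space, 'e::euclidean_space) atlas \<Rightarrow> 'a \<Rightarrow> 'e \<Rightarrow> 'a \<Rightarrow> 'e" where
  "coord_field A c v p = frechet_derivative (coord A p \<circ> param A c) (at (coord A c p)) v"

definition pushforward :: "('a::t2_space, 'e::euclidean_space) atlas \<Rightarrow>
    ('b::t2_space, 'f::euclidean_space) atlas \<Rightarrow> ('a \<Rightarrow> 'b) \<Rightarrow> 'a \<Rightarrow> 'e \<Rightarrow> 'f" where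
  "pushforward M N F p v = dir_deriv M (coord N (F p) \<circ> F) p v"

definition smooth_field_on ::
  "('a::t2_space, 'e::euclidean_space) atlas \<Rightarrow> 'a set \<Rightarrow> ('a \<Rightarrow> 'e) \<Rightarrow> bool" where
  "smooth_field_on A W X \<longleftrightarrow> (\<forall>c. smooth_fun_on A (W \<inter> chart_dom A c) (\<lambda>p. components A c p (X p)))"

definition lie_bracket :: "('a::t2_space, 'e::euclidean_space) atlas \<Rightarrow>
    ('a \<Rightarrow> 'e) \<Rightarrow> ('a \<Rightarrow> 'e) \<Rightarrow> 'a \<Rightarrow> 'e" where
  "lie_bracket A X Y p =
     dir_deriv A (\<lambda>q. components A p q (Y q)) p (X p) - dir_deriv A (\<lambda>q. components A p q (X q)) p (Y p)"

section \<open>Riemannian metrics, Levi-Civita connection, curvature\<close>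

definition riemannian_metric ::
  "('a::t2_space, 'e::euclidean_space) atlas \<Rightarrow> ('a \<Rightarrow> 'e \<Rightarrow> 'e \<Rightarrow> real) \<Rightarrow> bool" where
  "riemannian_metric A g \<longleftrightarrow>
     (\<forall>p. bilinear (g p) \<and> (\<forall>u v. g p u v = g p v u) \<and> (\<forall>v. v \<noteq> 0 \<longrightarrow> g p v v > 0)) \<and>
     (\<forall>W X Y. open W \<longrightarrow> smooth_field_on A W X \<longrightarrow> smooth_field_on A W Y \<longrightarrow>
        smooth_fun_on A W (\<lambda>p. g p (X p) (Y p)))"

definition riemannian_manifold ::
  "('a::t2_space, 'e::euclidean_space) atlas \<Rightarrow> ('a \<Rightarrow> 'e \<Rightarrow> 'e \<Rightarrow> real) \<Rightarrow> bool" where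
  "riemannian_manifold A g \<longleftrightarrow> smooth_manifold A \<and> riemannian_metric A g"

text \<open>
  Affine connections act on vector fields over arbitrary open sets; the first two conditions say
  that \<open>nab X Y\<close> is smooth and compatible with restriction.
\<close>

definition affine_connection :: "('a::t2_space, 'e::euclidean_space) atlas \<Rightarrow>
    (('a \<Rightarrow> 'e) \<Rightarrow> ('a \<Rightarrow> 'e) \<Rightarrow> 'a \<Rightarrow> 'e) \<Rightarrow> bool" where
  "affine_connection A nab \<longleftrightarrow>
     (\<forall>W X Y. open W \<longrightarrow> smooth_field_on A W X \<longrightarrow> smooth_field_on A W Y \<longrightarrow>
        smooth_field_on A W (nab X Y) \<and>
        (\<forall>X' Y'. (\<forall>p\<in>W. X' p = X p \<and> Y' p = Y p) \<longrightarrow> (\<forall>p\<in>W. nab X' Y' p = nab X Y p)) \<and>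
        (\<forall>Z. smooth_field_on A W Z \<longrightarrow>
           (\<forall>p\<in>W. nab (\<lambda>q. X q + Z q) Y p = nab X Y p + nab Z Y p \<and>
                   nab X (\<lambda>q. Y q + Z q) p = nab X Y p + nab X Z p)) \<and>
        (\<forall>f :: 'a \<Rightarrow> real. smooth_fun_on A W f \<longrightarrow>
           (\<forall>p\<in>W. nab (\<lambda>q. f q *\<^sub>R X q) Y p = f p *\<^sub>R nab X Y p \<and>
                   nab X (\<lambda>q. f q *\<^sub>R Y q) p = dir_deriv A f p (X p) *\<^sub>R Y p + f p *\<^sub>R nab X Y p)))"

definition levi_civita :: "('a::t2_space, 'e::euclidean_space) atlas \<Rightarrow>
    ('a \<Rightarrow> 'e \<Rightarrow> 'e \<Rightarrow> real) \<Rightarrow> (('a \<Rightarrow> 'e) \<Rightarrow> ('a \<Rightarrow> 'e) \<Rightarrow> 'a \<Rightarrow> 'e) \<Rightarrow> bool" where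
  "levi_civita A g nab \<longleftrightarrow> affine_connection A nab \<and>
     (\<forall>W X Y. open W \<longrightarrow> smooth_field_on A W X \<longrightarrow> smooth_field_on A W Y \<longrightarrow>
        (\<forall>p\<in>W. nab X Y p - nab Y X p = lie_bracket A X Y p) \<and>
        (\<forall>Z. smooth_field_on A W Z \<longrightarrow>
           (\<forall>p\<in>W. dir_deriv A (\<lambda>q. g q (Y q) (Z q)) p (X p) =
                   g p (nab X Y p) (Z p) + g p (Y p) (nab X Z p))))"

definition curvature :: "('a::t2_space, 'e::euclidean_space) atlas \<Rightarrow>
    (('a \<Rightarrow> 'e) \<Rightarrow> ('a \<Rightarrow> 'e) \<Rightarrow> 'a \<Rightarrow> 'e) \<Rightarrow> ('a \<Rightarrow> 'e) \<Rightarrow> ('a \<Rightarrow> 'e) \<Rightarrow> ('a \<Rightarrow> 'e) \<Rightarrow> 'a \<Rightarrow> 'e" where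
  "curvature A nab X Y Z p =
     nab X (nab Y Z) p - nab Y (nab X Z) p - nab (lie_bracket A X Y) Z p"

definition lie_deriv_metric :: "('a::t2_space, 'e::euclidean_space) atlas \<Rightarrow>
    ('a \<Rightarrow> 'e \<Rightarrow> 'e \<Rightarrow> real) \<Rightarrow> ('a \<Rightarrow> 'e) \<Rightarrow> ('a \<Rightarrow> 'e) \<Rightarrow> ('a \<Rightarrow> 'e) \<Rightarrow> 'a \<Rightarrow> real" where
  "lie_deriv_metric A g xi X Y p =
     dir_deriv A (\<lambda>q. g q (X q) (Y q)) p (xi p)
       - g p (lie_bracket A xi X p) (Y p) - g p (X p) (lie_bracket A xi Y p)"

section \<open>Distributions and local frames\<close>

definition smooth_distribution ::
  "('a::t2_space, 'e::euclidean_space) atlas \<Rightarrow> nat \<Rightarrow> ('a \<Rightarrow> 'e set) \<Rightarrow> bool" where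
  "smooth_distribution A k D \<longleftrightarrow>
     (\<forall>p. subspace (D p) \<and> dim (D p) = k) \<and>
     (\<forall>p. \<exists>W E. open W \<and> p \<in> W \<and> (\<forall>i<k. smooth_field_on A W (E i)) \<and>
        (\<forall>q\<in>W. D q = span ((\<lambda>i. E i q) ` {..<k})))"

definition section_on :: "('a::t2_space, 'e::euclidean_space) atlas \<Rightarrow>
    ('a \<Rightarrow> 'e set) \<Rightarrow> 'a set \<Rightarrow> ('a \<Rightarrow> 'e) \<Rightarrow> bool" where
  "section_on A D W X \<longleftrightarrow> smooth_field_on A W X \<and> (\<forall>p\<in>W. X p \<in> D p)"

definition orth_compl :: "('a \<Rightarrow> 'e \<Rightarrow> 'e \<Rightarrow> real) \<Rightarrow> ('a \<Rightarrow> 'e set) \<Rightarrow> 'a \<Rightarrow> 'e set" where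
  "orth_compl g D p = {v. \<forall>w \<in> D p. g p v w = 0}"

text \<open>\<open>D\<close> is totally geodesic at the points of \<open>S\<close>; for \<open>S = UNIV\<close>, it is totally geodesic.\<close>

definition totally_geodesic_distribution_at :: "('a::t2_space, 'e::euclidean_space) atlas \<Rightarrow>
    (('a \<Rightarrow> 'e) \<Rightarrow> ('a \<Rightarrow> 'e) \<Rightarrow> 'a \<Rightarrow> 'e) \<Rightarrow> ('a \<Rightarrow> 'e set) \<Rightarrow> 'a set \<Rightarrow> bool" where
  "totally_geodesic_distribution_at A nab D S \<longleftrightarrow>
     (\<forall>W U V. open W \<longrightarrow> section_on A D W U \<longrightarrow> section_on A D W V \<longrightarrow>
        (\<forall>p \<in> W \<inter> S. nab U V p \<in> D p))"

definition local_orthonormal_frame :: "('a::t2_space, 'e::euclidean_space) atlas \<Rightarrow>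
    ('a \<Rightarrow> 'e \<Rightarrow> 'e \<Rightarrow> real) \<Rightarrow> ('a \<Rightarrow> 'e set) \<Rightarrow> 'a set \<Rightarrow> nat set \<Rightarrow> (nat \<Rightarrow> 'a \<Rightarrow> 'e) \<Rightarrow> bool" where
  "local_orthonormal_frame A g D W J E \<longleftrightarrow> open W \<and> finite J \<and>
     (\<forall>j\<in>J. section_on A D W (E j)) \<and>
     (\<forall>p\<in>W. (\<forall>i\<in>J. \<forall>j\<in>J. g p (E i p) (E j p) = (if i = j then 1 else 0)) \<and>
             span ((\<lambda>j. E j p) ` J) = D p)"

text \<open>
  The Ricci tensor of the manifold, when \<open>E\<close> is an orthonormal frame of the tangent bundle, and
  the Ricci tensor of a distribution, when \<open>E\<close> is an orthonormal frame of it; likewise for the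
  scalar curvature. Both are independent of the frame, so statements about them are made for all
  local orthonormal frames.
\<close>

definition ric :: "('a::t2_space, 'e::euclidean_space) atlas \<Rightarrow> ('a \<Rightarrow> 'e \<Rightarrow> 'e \<Rightarrow> real) \<Rightarrow>
    (('a \<Rightarrow> 'e) \<Rightarrow> ('a \<Rightarrow> 'e) \<Rightarrow> 'a \<Rightarrow> 'e) \<Rightarrow> nat set \<Rightarrow> (nat \<Rightarrow> 'a \<Rightarrow> 'e) \<Rightarrow>
    ('a \<Rightarrow> 'e) \<Rightarrow> ('a \<Rightarrow> 'e) \<Rightarrow> 'a \<Rightarrow> real" where
  "ric A g nab J E X Y p = (\<Sum>j\<in>J. g p (curvature A nab (E j) X Y p) (E j p))"

definition scalar_curv :: "('a::t2_space, 'e::euclidean_space) atlas \<Rightarrow> ('a \<Rightarrow> 'e \<Rightarrow> 'e \<Rightarrow> real) \<Rightarrow>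
    (('a \<Rightarrow> 'e) \<Rightarrow> ('a \<Rightarrow> 'e) \<Rightarrow> 'a \<Rightarrow> 'e) \<Rightarrow> nat set \<Rightarrow> (nat \<Rightarrow> 'a \<Rightarrow> 'e) \<Rightarrow> 'a \<Rightarrow> real" where
  "scalar_curv A g nab J E p = (\<Sum>j\<in>J. ric A g nab J E (E j) (E j) p)"

definition ricci_soliton :: "('a::t2_space, 'e::euclidean_space) atlas \<Rightarrow>
    ('a \<Rightarrow> 'e \<Rightarrow> 'e \<Rightarrow> real) \<Rightarrow> (('a \<Rightarrow> 'e) \<Rightarrow> ('a \<Rightarrow> 'e) \<Rightarrow> 'a \<Rightarrow> 'e) \<Rightarrow> ('a \<Rightarrow> 'e) \<Rightarrow> real \<Rightarrow> bool" where
  "ricci_soliton A g nab xi lam \<longleftrightarrow> smooth_field_on A UNIV xi \<and>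
     (\<forall>W E X Y. local_orthonormal_frame A g (\<lambda>_. UNIV) W {1..DIM('e)} E \<longrightarrow>
        smooth_field_on A W X \<longrightarrow> smooth_field_on A W Y \<longrightarrow>
        (\<forall>p\<in>W. 1/2 * lie_deriv_metric A g xi X Y p + ric A g nab {1..DIM('e)} E X Y p
                 + lam * g p (X p) (Y p) = 0))"

section \<open>Riemannian maps\<close>

abbreviation ker_push :: "('a::t2_space, 'e::euclidean_space) atlas \<Rightarrow>
    ('b::t2_space, 'f::euclidean_space) atlas \<Rightarrow> ('a \<Rightarrow> 'b) \<Rightarrow> 'a \<Rightarrow> 'e set" where
  "ker_push M N F p \<equiv> {v. pushforward M N F p v = 0}"

abbreviation range_push :: "('a::t2_space, 'e::euclidean_space) atlas \<Rightarrow>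
    ('b::t2_space, 'f::euclidean_space) atlas \<Rightarrow> ('a \<Rightarrow> 'b) \<Rightarrow> 'a \<Rightarrow> 'f set" where
  "range_push M N F p \<equiv> range (pushforward M N F p)"

definition riemannian_map ::
  "('a::t2_space, 'e::euclidean_space) atlas \<Rightarrow> ('a \<Rightarrow> 'e \<Rightarrow> 'e \<Rightarrow> real) \<Rightarrow>
   ('b::t2_space, 'f::euclidean_space) atlas \<Rightarrow> ('b \<Rightarrow> 'f \<Rightarrow> 'f \<Rightarrow> real) \<Rightarrow> ('a \<Rightarrow> 'b) \<Rightarrow> bool" where
  "riemannian_map M gM N gN F \<longleftrightarrow> smooth_map M N F \<and>
     (\<forall>p. 0 < dim (range_push M N F p) \<and> dim (range_push M N F p) \<le> min DIM('e) DIM('f) \<and>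
          pushforward M N F p ` orth_compl gM (ker_push M N F) p = range_push M N F p \<and>
          (\<forall>u \<in> orth_compl gM (ker_push M N F) p. \<forall>v \<in> orth_compl gM (ker_push M N F) p.
             gN (F p) (pushforward M N F p u) (pushforward M N F p v) = gM p u v))"

text \<open>
  The pullback along \<open>F\<close> of a connection on \<open>N\<close>, applied to a vector field \<open>X\<close> on \<open>M\<close> and a
  section \<open>s\<close> of the pullback bundle (\<open>s p\<close> is tangent to \<open>N\<close> at \<open>F p\<close>). In the coordinate frame
  \<open>\<partial>\<^sub>b = coord_field N (F p) b\<close> around \<open>F p\<close> write \<open>s = (\<Sum>b. s\<^sup>b *\<^sub>R (\<partial>\<^sub>b \<circ> F))\<close>; the Leibniz rule gives
  \<open>(\<Sum>b. X(s\<^sup>b) *\<^sub>R \<partial>\<^sub>b + s\<^sup>b *\<^sub>R nab (F\<^sub>*X) \<partial>\<^sub>b)\<close>, where \<open>F\<^sub>*X\<close> may be replaced by any field on \<open>N\<close> with the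
  same value at \<open>F p\<close>. At \<open>F p\<close> itself, \<open>\<partial>\<^sub>b = b\<close>.
\<close>

definition pullback_connection :: "('a::t2_space, 'e::euclidean_space) atlas \<Rightarrow>
    ('b::t2_space, 'f::euclidean_space) atlas \<Rightarrow> (('b \<Rightarrow> 'f) \<Rightarrow> ('b \<Rightarrow> 'f) \<Rightarrow> 'b \<Rightarrow> 'f) \<Rightarrow>
    ('a \<Rightarrow> 'b) \<Rightarrow> ('a \<Rightarrow> 'e) \<Rightarrow> ('a \<Rightarrow> 'f) \<Rightarrow> 'a \<Rightarrow> 'f" where
  "pullback_connection M N nabN F X s p =
     dir_deriv M (\<lambda>q. components N (F p) (F q) (s q)) p (X p) +
     (\<Sum>b\<in>Basis. (s p \<bullet> b) *\<^sub>R
        nabN (coord_field N (F p) (pushforward M N F p (X p))) (coord_field N (F p) b) (F p))"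

definition second_fundamental_form :: "('a::t2_space, 'e::euclidean_space) atlas \<Rightarrow>
    (('a \<Rightarrow> 'e) \<Rightarrow> ('a \<Rightarrow> 'e) \<Rightarrow> 'a \<Rightarrow> 'e) \<Rightarrow> ('b::t2_space, 'f::euclidean_space) atlas \<Rightarrow>
    (('b \<Rightarrow> 'f) \<Rightarrow> ('b \<Rightarrow> 'f) \<Rightarrow> 'b \<Rightarrow> 'f) \<Rightarrow> ('a \<Rightarrow> 'b) \<Rightarrow> ('a \<Rightarrow> 'e) \<Rightarrow> ('a \<Rightarrow> 'e) \<Rightarrow> 'a \<Rightarrow> 'f" where
  "second_fundamental_form M nabM N nabN F X Y p =
     pullback_connection M N nabN F X (\<lambda>q. pushforward M N F q (Y q)) p
       - pushforward M N F p (nabM X Y p)"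

definition totally_geodesic_map :: "('a::t2_space, 'e::euclidean_space) atlas \<Rightarrow>
    (('a \<Rightarrow> 'e) \<Rightarrow> ('a \<Rightarrow> 'e) \<Rightarrow> 'a \<Rightarrow> 'e) \<Rightarrow> ('b::t2_space, 'f::euclidean_space) atlas \<Rightarrow>
    (('b \<Rightarrow> 'f) \<Rightarrow> ('b \<Rightarrow> 'f) \<Rightarrow> 'b \<Rightarrow> 'f) \<Rightarrow> ('a \<Rightarrow> 'b) \<Rightarrow> bool" where
  "totally_geodesic_map M nabM N nabN F \<longleftrightarrow>
     (\<forall>W X Y. open W \<longrightarrow> smooth_field_on M W X \<longrightarrow> smooth_field_on M W Y \<longrightarrow>
        (\<forall>p\<in>W. second_fundamental_form M nabM N nabN F X Y p = 0))"

text \<open>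
  \<open>D\<close> is \<open>range F\<^sub>*\<close> regarded as a distribution of rank \<open>k\<close> on all of \<open>N\<close>: at the points \<open>F p\<close> it is
  the range of the differential.

  This does not determine \<open>D\<close> off the closure of the image of \<open>F\<close>, and a totally geodesic map \<open>F\<close>
  makes \<open>D\<close> totally geodesic only at the points of that closure. To say that \<open>F\<close> is totally
  geodesic with \<open>range F\<^sub>*\<close> regarded as a distribution on \<open>N\<close>, one has to add
  \<open>totally_geodesic_distribution_at N nabN D (- closure (range F))\<close>, which is void if the image
  is dense. It cannot be dropped: take the inclusion of the equator in the round 2-sphere without
  its poles, \<open>D\<close> tangent to the parallels, and \<open>xi = 0\<close>. Everything else holds with \<open>lam = -1\<close>,
  \<open>m - r = 1\<close>, but the scalar curvature of \<open>D\<close> is 0.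
\<close>

definition range_distribution :: "('a::t2_space, 'e::euclidean_space) atlas \<Rightarrow>
    ('b::t2_space, 'f::euclidean_space) atlas \<Rightarrow> ('a \<Rightarrow> 'b) \<Rightarrow> nat \<Rightarrow> ('b \<Rightarrow> 'f set) \<Rightarrow> bool" where
  "range_distribution M N F k D \<longleftrightarrow>
     smooth_distribution N k D \<and> (\<forall>p. D (F p) = range_push M N F p)"

end

theory Submission
  imports Defs
begin

text \<open>
  Both \<open>D\<close> and its orthogonal complement are totally geodesic, so \<open>D\<close> is parallel: for \<open>X\<close> in \<open>D\<close> and
  \<open>V\<close> in its complement, \<open>g(\<nabla>\<^sub>Z X, V) = - g(X, \<nabla>\<^sub>Z V)\<close> vanishes whether \<open>Z\<close> lies in \<open>D\<close> or in the complement.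
  Hence \<open>g(R(V, X)X, V) = 0\<close>, and \<open>Ric(X, X)\<close> is a trace over \<open>D\<close> only. Moreover
  \<open>(L\<^sub>\<xi> g)(X, X) = 2 g(\<nabla>\<^sub>X \<xi>, X) = - 2 g(\<xi>, \<nabla>\<^sub>X X) = 0\<close>, and the soliton equation summed over an orthonormal
  frame of \<open>D\<close> gives the claim. That \<open>D\<close> is totally geodesic on the closure of the image of \<open>F\<close> follows
  at image points from metric compatibility of the pullback connection, and then by continuity.
\<close>

section \<open>Smooth functions\<close>

lemma differentiable_transform_open:
  assumes "f differentiable at x" "open S" "x \<in> S" "\<And>y. y \<in> S \<Longrightarrow> f y = g y"
  shows "g differentiable at x"
  using assms has_derivative_transform_within_open unfolding differentiable_def by blast

text \<open>A Frechet derivative depends only on the germ of the function, so on an open set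
  equality of the functions passes to all their directional derivatives, and the induction runs
  through them.\<close>

lemma Ck_on_cong:
  assumes "open S" "\<And>x. x \<in> S \<Longrightarrow> f x = g x" "Ck_on k S f"
  shows "Ck_on k S g"
  using assms(2,3)
proof (induction k arbitrary: f g)
  case 0
  then show ?case using continuous_on_cong[of S S f g] by simp
next
  case (Suc k)
  have "g differentiable at x" if "x \<in> S" for x
    using differentiable_transform_open[OF _ assms(1) that] Suc.prems that by auto
  moreover have "Ck_on k S (\<lambda>x. frechet_derivative g (at x) v)" for v
  proof (rule Suc.IH)
    show "Ck_on k S (\<lambda>x. frechet_derivative f (at x) v)" using Suc.prems by simp
    show "frechet_derivative f (at x) v = frechet_derivative g (at x) v" if "x \<in> S" for x
      using frechet_derivative_transform_within_open[OF _ assms(1) that, of f g] Suc.prems that by simp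
  qed
  ultimately show ?case by simp
qed

lemma Ck_on_subset: "Ck_on k S f \<Longrightarrow> T \<subseteq> S \<Longrightarrow> Ck_on k T f"
  by (induction k arbitrary: f) (auto intro: continuous_on_subset)

lemma Ck_on_SucD: "Ck_on (Suc k) S f \<Longrightarrow> Ck_on k S f"
proof (induction k arbitrary: f)
  case 0
  then show ?case
    by (auto intro!: continuous_at_imp_continuous_on differentiable_imp_continuous_within)
next
  case (Suc k)
  show ?case
    unfolding Ck_on.simps(2)[of k]
    using Suc.prems Suc.IH unfolding Ck_on.simps(2)[of "Suc k"] by blast
qed

lemma Ck_on_const: "Ck_on k S (\<lambda>_. c)"
  by (induction k arbitrary: c) auto

lemma Ck_on_add:
  assumes "open S" "Ck_on k S f" "Ck_on k S g"
  shows "Ck_on k S (\<lambda>x. f x + g x)"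
  using assms(2,3)
proof (induction k arbitrary: f g)
  case 0
  then show ?case by (auto intro: continuous_on_add)
next
  case (Suc k)
  have "Ck_on k S (\<lambda>x. frechet_derivative (\<lambda>x. f x + g x) (at x) v)" for v
  proof (rule Ck_on_cong[OF assms(1)])
    show "Ck_on k S (\<lambda>x. frechet_derivative f (at x) v + frechet_derivative g (at x) v)"
      using Suc by simp
    fix x assume "x \<in> S"
    then have "f differentiable at x" "g differentiable at x" using Suc.prems by auto
    then have "((\<lambda>x. f x + g x) has_derivative
        (\<lambda>v. frechet_derivative f (at x) v + frechet_derivative g (at x) v)) (at x)"
      by (intro has_derivative_add) (simp_all add: frechet_derivative_works)
    from frechet_derivative_at[OF this]
    show "frechet_derivative f (at x) v + frechet_derivative g (at x) v
        = frechet_derivative (\<lambda>x. f x + g x) (at x) v" by metis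
  qed
  then show ?case using Suc.prems by (auto intro: differentiable_add)
qed

lemma Ck_on_sum:
  assumes "open S" "\<And>i. i \<in> I \<Longrightarrow> Ck_on k S (f i)"
  shows "Ck_on k S (\<lambda>x. \<Sum>i\<in>I. f i x)"
  using assms(2)
  by (induction I rule: infinite_finite_induct) (auto intro: Ck_on_add[OF assms(1)] Ck_on_const)

text \<open>By the product rule each directional derivative is a sum of two products, in each of
  which one factor is a derivative and the other is the original function with one order of
  smoothness given up. This covers scaling, inner products and real multiplication at once.\<close>

lemma (in bounded_bilinear) Ck_on_prod:
  assumes "open S" "Ck_on k S f" "Ck_on k S g"
  shows "Ck_on k S (\<lambda>x. prod (f x) (g x))"
  using assms(2,3)
proof (induction k arbitrary: f g)
  case 0
  then show ?case by (auto intro: continuous_on)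
next
  case (Suc k)
  have D: "((\<lambda>x. prod (f x) (g x)) has_derivative
      (\<lambda>v. prod (f x) (frechet_derivative g (at x) v) + prod (frechet_derivative f (at x) v) (g x))) (at x)"
    if "x \<in> S" for x
    using Suc.prems that by (intro FDERIV) (auto simp: frechet_derivative_works[symmetric])
  have "Ck_on k S (\<lambda>x. frechet_derivative (\<lambda>x. prod (f x) (g x)) (at x) v)" for v
  proof (rule Ck_on_cong[OF assms(1)])
    show "Ck_on k S
      (\<lambda>x. prod (f x) (frechet_derivative g (at x) v) + prod (frechet_derivative f (at x) v) (g x))"
      using Suc Ck_on_SucD[OF Suc.prems(1)] Ck_on_SucD[OF Suc.prems(2)]
      by (intro Ck_on_add[OF assms(1)]) simp_all
  qed (simp add: frechet_derivative_at[OF D, symmetric])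
  then show ?case using D by (auto simp: differentiable_def)
qed

text \<open>The chain rule gives the derivative of \<open>f\<close> in the direction
  \<open>Dg(x) v\<close>, which varies with \<open>x\<close>, whereas \<open>Ck_on\<close> speaks of
  fixed directions. Expanding this direction in the basis of the intermediate space gives a finite
  sum of coordinates of \<open>Dg(x) v\<close> times partial derivatives of \<open>f\<close>
  composed with \<open>g\<close>, to which the induction hypothesis applies.\<close>

lemma Ck_on_compose:
  fixes f :: "'v::euclidean_space \<Rightarrow> 'w::real_normed_vector" and g :: "'u::real_normed_vector \<Rightarrow> 'v"
  assumes "open S" "Ck_on k T f" "Ck_on k S g" "g ` S \<subseteq> T"
  shows "Ck_on k S (f \<circ> g)"
  using assms(2,3)
proof (induction k arbitrary: f)
  case 0
  then show ?case
    using assms(4) by (metis Ck_on.simps(1) continuous_on_compose continuous_on_subset)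
next
  case (Suc k)
  have diff: "f differentiable at (g x)" "g differentiable at x" if "x \<in> S" for x
    using Suc.prems assms(4) that by auto
  have "Ck_on k S (\<lambda>x. frechet_derivative (f \<circ> g) (at x) v)" for v
  proof (rule Ck_on_cong[OF assms(1)])
    have "Ck_on k S (\<lambda>x. frechet_derivative f (at (g x)) b)" for b
      using Suc.IH[of "\<lambda>x. frechet_derivative f (at x) b"] Suc.prems(1) Ck_on_SucD[OF Suc.prems(2)]
      by (simp add: o_def)
    moreover have "Ck_on k S (\<lambda>x. frechet_derivative g (at x) v \<bullet> b)" for b
      using Suc.prems(2)
      by (intro bounded_bilinear.Ck_on_prod[OF bounded_bilinear_inner] assms(1) Ck_on_const) simp
    ultimately show "Ck_on k S
      (\<lambda>x. \<Sum>b\<in>Basis. (frechet_derivative g (at x) v \<bullet> b) *\<^sub>R frechet_derivative f (at (g x)) b)"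
      by (intro Ck_on_sum bounded_bilinear.Ck_on_prod[OF bounded_bilinear_scaleR] assms(1))
    fix x assume "x \<in> S"
    note d = diff[OF this]
    have "frechet_derivative (f \<circ> g) (at x) v = frechet_derivative f (at (g x)) (frechet_derivative g (at x) v)"
      using frechet_derivative_compose[OF d(2,1)] by simp
    also have "\<dots> = frechet_derivative f (at (g x))
        (\<Sum>b\<in>Basis. (frechet_derivative g (at x) v \<bullet> b) *\<^sub>R b)"
      by (simp add: euclidean_representation)
    also have "\<dots> = (\<Sum>b\<in>Basis. (frechet_derivative g (at x) v \<bullet> b) *\<^sub>R frechet_derivative f (at (g x)) b)"
      using linear_frechet_derivative[OF d(1)] by (simp add: linear_sum linear_cmul)
    finally show "(\<Sum>b\<in>Basis. (frechet_derivative g (at x) v \<bullet> b) *\<^sub>R frechet_derivative f (at (g x)) b)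
        = frechet_derivative (f \<circ> g) (at x) v" by simp
  qed
  then show ?case
    unfolding Ck_on.simps using diff differentiable_chain_at by blast
qed

text \<open>Differentiation lowers the exponent by 1, so the induction is over all exponents
  simultaneously. The exponent -1/2 later normalises vector fields.\<close>

lemma Ck_on_powr:
  fixes f :: "'v::real_normed_vector \<Rightarrow> real"
  assumes "open S" "Ck_on k S f" "\<And>x. x \<in> S \<Longrightarrow> f x > 0"
  shows "Ck_on k S (\<lambda>x. f x powr a)"
  using assms(2)
proof (induction k arbitrary: a)
  case 0
  then show ?case using assms(3) by (force intro!: continuous_on_powr continuous_on_const)
next
  case (Suc k)
  have D: "((\<lambda>x. f x powr a) has_derivative
      (\<lambda>v. (a * f x powr (a - 1)) * frechet_derivative f (at x) v)) (at x)" if "x \<in> S" for x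
  proof -
    have pos: "f x > 0" using assms(3) that by simp
    have "(f has_derivative frechet_derivative f (at x)) (at x)"
      using Suc.prems that by (auto simp: frechet_derivative_works[symmetric])
    from has_derivative_powr[OF this has_derivative_const[of a] pos]
    show ?thesis
      using pos by (simp add: powr_diff field_simps)
  qed
  have "Ck_on k S (\<lambda>x. frechet_derivative (\<lambda>x. f x powr a) (at x) v)" for v
  proof (rule Ck_on_cong[OF assms(1)])
    show "Ck_on k S (\<lambda>x. (a * f x powr (a - 1)) * frechet_derivative f (at x) v)"
      using Suc Ck_on_SucD[OF Suc.prems]
      by (intro bounded_bilinear.Ck_on_prod[OF bounded_bilinear_mult] assms(1) Ck_on_const) simp_all
  qed (simp add: frechet_derivative_at[OF D, symmetric])
  then show ?case using D by (auto simp: differentiable_def)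
qed

section \<open>Passage from finite order to smooth functions\<close>

lemma smooth_on_cong: "smooth_on S f \<Longrightarrow> open S \<Longrightarrow> (\<And>x. x \<in> S \<Longrightarrow> f x = g x) \<Longrightarrow> smooth_on S g"
  unfolding smooth_on_def using Ck_on_cong by blast

lemma smooth_on_subset: "smooth_on S f \<Longrightarrow> T \<subseteq> S \<Longrightarrow> smooth_on T f"
  unfolding smooth_on_def using Ck_on_subset by blast

lemma smooth_on_compose:
  fixes f :: "'v::euclidean_space \<Rightarrow> 'w::real_normed_vector"
  shows "smooth_on T f \<Longrightarrow> smooth_on S g \<Longrightarrow> open S \<Longrightarrow> g ` S \<subseteq> T \<Longrightarrow> smooth_on S (f \<circ> g)"
  unfolding smooth_on_def using Ck_on_compose by blast

lemma smooth_on_differentiable: "smooth_on S f \<Longrightarrow> x \<in> S \<Longrightarrow> f differentiable at x"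
  unfolding smooth_on_def using Ck_on.simps(2) by blast

lemma smooth_on_frechet_derivative:
  "smooth_on S f \<Longrightarrow> smooth_on S (\<lambda>x. frechet_derivative f (at x) v)"
  unfolding smooth_on_def using Ck_on.simps(2) by blast

lemma smooth_on_continuous: "smooth_on S f \<Longrightarrow> continuous_on S f"
  unfolding smooth_on_def using Ck_on.simps(1) by blast

section \<open>Charts, smooth functions and vector fields\<close>

locale manifold =
  fixes A :: "('a::t2_space, 'e::euclidean_space) atlas"
  assumes smooth_manifold: "smooth_manifold A"
begin

section \<open>Charts and smooth functions on a manifold\<close>

lemma center_in_chart [simp]: "c \<in> chart_dom A c"
  and open_chart_dom [simp]: "open (chart_dom A c)"
  and open_coord_chart_dom: "open (coord A c ` chart_dom A c)"
  and coord_homeomorphism: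
    "homeomorphism (chart_dom A c) (coord A c ` chart_dom A c) (coord A c) (param A c)"
  and smooth_transition:
    "smooth_on (coord A c ` (chart_dom A c \<inter> chart_dom A d)) (coord A d \<circ> param A c)"
  using smooth_manifold unfolding smooth_manifold_def by blast+

lemma param_coord [simp]: "p \<in> chart_dom A c \<Longrightarrow> param A c (coord A c p) = p"
  using coord_homeomorphism homeomorphism_apply1 by blast

lemma continuous_on_coord: "continuous_on (chart_dom A c) (coord A c)"
  using coord_homeomorphism homeomorphism_cont1 by blast

lemma open_coord_image:
  assumes "open W"
  shows "open (coord A c ` (W \<inter> chart_dom A c))"
proof -
  have "openin (top_of_set (coord A c ` chart_dom A c)) (coord A c ` (W \<inter> chart_dom A c))"
    using assms
    by (intro homeomorphism_imp_open_map[OF coord_homeomorphism]) (auto simp: openin_open)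
  then show ?thesis using open_coord_chart_dom openin_open_trans by blast
qed

lemma smooth_fun_on_differentiable:
  assumes "smooth_fun_on A W f" "p \<in> W" "p \<in> chart_dom A c"
  shows "(f \<circ> param A c) differentiable (at (coord A c p))"
  using assms smooth_on_differentiable unfolding smooth_fun_on_def by blast

lemma transition_differentiable:
  "p \<in> chart_dom A c \<Longrightarrow> p \<in> chart_dom A d \<Longrightarrow>
     (coord A d \<circ> param A c) differentiable (at (coord A c p))"
  using smooth_transition smooth_on_differentiable by blast

lemma smooth_fun_on_coord: "smooth_fun_on A (chart_dom A c) (coord A c)"
  unfolding smooth_fun_on_def Int_commute[of "chart_dom A c"] using smooth_transition by blast

lemma smooth_fun_on_cong:
  assumes "smooth_fun_on A W f" "open W" "\<And>p. p \<in> W \<Longrightarrow> f p = g p"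
  shows "smooth_fun_on A W g"
  unfolding smooth_fun_on_def
proof
  fix c
  show "smooth_on (coord A c ` (W \<inter> chart_dom A c)) (g \<circ> param A c)"
    by (rule smooth_on_cong[of _ "f \<circ> param A c"])
      (use assms in \<open>auto simp: smooth_fun_on_def open_coord_image\<close>)
qed

lemma smooth_fun_on_subset: "smooth_fun_on A W f \<Longrightarrow> V \<subseteq> W \<Longrightarrow> smooth_fun_on A V f"
  unfolding smooth_fun_on_def
  by (intro allI) (rule smooth_on_subset, erule spec, rule image_mono, rule Int_mono, simp_all)

lemma smooth_fun_on_const: "smooth_fun_on A W (\<lambda>_. c)"
  unfolding smooth_fun_on_def smooth_on_def o_def by (simp add: Ck_on_const)

lemma smooth_fun_on_add:
  "open W \<Longrightarrow> smooth_fun_on A W f \<Longrightarrow> smooth_fun_on A W g \<Longrightarrow> smooth_fun_on A W (\<lambda>p. f p + g p)"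
  unfolding smooth_fun_on_def smooth_on_def o_def by (simp add: Ck_on_add open_coord_image)

lemma smooth_fun_on_bilinear:
  assumes "bounded_bilinear B" "open W" "smooth_fun_on A W f" "smooth_fun_on A W g"
  shows "smooth_fun_on A W (\<lambda>p. B (f p) (g p))"
  using assms(2-) unfolding smooth_fun_on_def smooth_on_def o_def
  by (simp add: bounded_bilinear.Ck_on_prod[OF assms(1)] open_coord_image)

lemmas smooth_fun_on_scaleR = smooth_fun_on_bilinear[OF bounded_bilinear_scaleR]

lemma smooth_fun_on_powr:
  fixes f :: "'a \<Rightarrow> real"
  assumes "open W" "smooth_fun_on A W f" "\<And>p. p \<in> W \<Longrightarrow> f p > 0"
  shows "smooth_fun_on A W (\<lambda>p. f p powr a)"
  using assms unfolding smooth_fun_on_def smooth_on_def o_def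
  by (auto intro!: Ck_on_powr open_coord_image)

text \<open>Smoothness in a single chart suffices: read in another chart \<open>d\<close>, the
  function is \<open>h\<close> composed with a transition map.\<close>

lemma smooth_fun_on_coord_compose:
  assumes "smooth_on (coord A c ` W) h" "open W" "W \<subseteq> chart_dom A c"
  shows "smooth_fun_on A W (h \<circ> coord A c)"
  unfolding smooth_fun_on_def
proof
  fix d
  have "smooth_on (coord A d ` (W \<inter> chart_dom A d)) (h \<circ> (coord A c \<circ> param A d))"
  proof (rule smooth_on_compose[OF assms(1)])
    show "smooth_on (coord A d ` (W \<inter> chart_dom A d)) (coord A c \<circ> param A d)"
      using assms(3) by (intro smooth_on_subset[OF smooth_transition[of d c]]) auto
  qed (use assms in \<open>auto intro: open_coord_image\<close>)
  then show "smooth_on (coord A d ` (W \<inter> chart_dom A d)) (h \<circ> coord A c \<circ> param A d)"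
    by (simp add: o_assoc)
qed

lemma smooth_fun_on_continuous:
  assumes "smooth_fun_on A W f" "open W"
  shows "continuous_on W f"
proof (rule continuous_at_imp_continuous_on, rule ballI)
  fix p assume p: "p \<in> W"
  let ?V = "W \<inter> chart_dom A p"
  have "continuous_on ?V ((f \<circ> param A p) \<circ> coord A p)"
    using assms(1) unfolding smooth_fun_on_def
    by (intro continuous_on_compose continuous_on_subset[OF continuous_on_coord] smooth_on_continuous) auto
  then have "continuous_on ?V f"
    by (rule continuous_on_eq) simp
  then show "isCont f p"
    using p assms(2) by (simp add: continuous_on_eq_continuous_at open_Int)
qed

text \<open>This is the chain rule for inserting a transition map into
  \<open>f \<circ> param A c\<close>. The factorisation holds only on the overlap of the two charts,
  which is open, and this is enough for the derivative at the point.\<close>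

lemma frechet_derivative_change_chart:
  assumes "p \<in> chart_dom A c" "p \<in> chart_dom A d" "(f \<circ> param A d) differentiable (at (coord A d p))"
  shows "frechet_derivative (f \<circ> param A c) (at (coord A c p)) v =
    frechet_derivative (f \<circ> param A d) (at (coord A d p))
      (frechet_derivative (coord A d \<circ> param A c) (at (coord A c p)) v)"
proof -
  let ?T = "coord A d \<circ> param A c"
  have pd: "?T (coord A c p) = coord A d p" using assms by simp
  have dT: "?T differentiable (at (coord A c p))" using assms by (intro transition_differentiable)
  have "frechet_derivative ((f \<circ> param A d) \<circ> ?T) (at (coord A c p)) =
      frechet_derivative (f \<circ> param A c) (at (coord A c p))"
  proof (rule frechet_derivative_transform_within_open)
    show "((f \<circ> param A d) \<circ> ?T) differentiable (at (coord A c p))"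
      using assms(3) by (intro differentiable_chain_at[OF dT]) (simp only: pd)
    show "open (coord A c ` (chart_dom A d \<inter> chart_dom A c))" by (intro open_coord_image) simp
  qed (use assms in auto)
  moreover have "frechet_derivative ((f \<circ> param A d) \<circ> ?T) (at (coord A c p)) =
      frechet_derivative (f \<circ> param A d) (at (coord A d p)) \<circ> frechet_derivative ?T (at (coord A c p))"
    using frechet_derivative_compose[OF dT, of "f \<circ> param A d"] assms(3) pd by simp
  ultimately show ?thesis by (simp add: fun_eq_iff)
qed

lemma frechet_derivative_coord_self:
  assumes "p \<in> chart_dom A c"
  shows "frechet_derivative (coord A c \<circ> param A c) (at (coord A c p)) v = v"
proof -
  have "frechet_derivative (\<lambda>x. x) (at (coord A c p)) =
      frechet_derivative (coord A c \<circ> param A c) (at (coord A c p))"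
    using assms open_coord_chart_dom[of c]
    by (intro frechet_derivative_transform_within_open) auto
  from fun_cong[OF this, of v] show ?thesis by simp
qed

section \<open>Components of tangent vectors and coordinate fields\<close>

lemma components_eq:
  "components A c p v = frechet_derivative (coord A c \<circ> param A p) (at (coord A p p)) v"
  by (simp add: components_def dir_deriv_def)

lemma components_self [simp]: "components A p p v = v"
  by (simp add: components_eq frechet_derivative_coord_self)

lemma linear_components: "p \<in> chart_dom A c \<Longrightarrow> linear (components A c p)"
  unfolding components_eq[abs_def] by (intro linear_frechet_derivative transition_differentiable) simp_all

lemma linear_coord_field: "p \<in> chart_dom A c \<Longrightarrow> linear (\<lambda>v. coord_field A c v p)"
  unfolding coord_field_def[abs_def] by (intro linear_frechet_derivative transition_differentiable) simp_all

lemma components_coord_field: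
  assumes "p \<in> chart_dom A c" "p \<in> chart_dom A d"
  shows "components A d p (coord_field A c v p) =
    frechet_derivative (coord A d \<circ> param A c) (at (coord A c p)) v"
  unfolding components_eq coord_field_def
  using assms
  by (intro frechet_derivative_change_chart[symmetric] transition_differentiable) simp_all

text \<open>The derivatives of the transition maps from \<open>p\<close> to \<open>c\<close> and
  back are mutually inverse. Thus every tangent vector at \<open>p\<close> is the value of the
  coordinate field built from its components, which allows vectors to be expanded in a coordinate
  frame.\<close>

lemma coord_field_components:
  assumes "p \<in> chart_dom A c"
  shows "coord_field A c (components A c p v) p = v"
proof -
  have "frechet_derivative (coord A p \<circ> param A p) (at (coord A p p)) v =
      frechet_derivative (coord A p \<circ> param A c) (at (coord A c p))
        (frechet_derivative (coord A c \<circ> param A p) (at (coord A p p)) v)"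
    using assms by (intro frechet_derivative_change_chart transition_differentiable) simp_all
  then show ?thesis by (simp add: components_eq coord_field_def frechet_derivative_coord_self)
qed

lemma coord_field_self [simp]: "coord_field A p v p = v"
  using coord_field_components[of p p v] by simp

lemma smooth_field_on_coord_field: "smooth_field_on A (chart_dom A c) (coord_field A c v)"
  unfolding smooth_field_on_def
proof
  fix d
  let ?W = "chart_dom A c \<inter> chart_dom A d"
  show "smooth_fun_on A ?W (\<lambda>p. components A d p (coord_field A c v p))"
  proof (rule smooth_fun_on_cong)
    show "smooth_fun_on A ?W
        ((\<lambda>x. frechet_derivative (coord A d \<circ> param A c) (at x) v) \<circ> coord A c)"
      by (intro smooth_fun_on_coord_compose smooth_on_frechet_derivative smooth_transition) auto
  qed (auto simp: components_coord_field)
qed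

section \<open>Closure properties of smooth vector fields\<close>

lemma smooth_field_on_subset: "smooth_field_on A W X \<Longrightarrow> V \<subseteq> W \<Longrightarrow> smooth_field_on A V X"
  unfolding smooth_field_on_def
  by (intro allI) (rule smooth_fun_on_subset, erule spec, rule Int_mono, simp_all)

lemma smooth_field_on_cong:
  assumes "smooth_field_on A W X" "open W" "\<And>p. p \<in> W \<Longrightarrow> X p = Y p"
  shows "smooth_field_on A W Y"
  unfolding smooth_field_on_def
proof
  fix c
  show "smooth_fun_on A (W \<inter> chart_dom A c) (\<lambda>p. components A c p (Y p))"
    by (rule smooth_fun_on_cong[of _ "\<lambda>p. components A c p (X p)"])
      (use assms in \<open>auto simp: smooth_field_on_def\<close>)
qed

lemma smooth_field_on_add:
  assumes "open W" "smooth_field_on A W X" "smooth_field_on A W Y"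
  shows "smooth_field_on A W (\<lambda>p. X p + Y p)"
  unfolding smooth_field_on_def
proof
  fix c
  show "smooth_fun_on A (W \<inter> chart_dom A c) (\<lambda>p. components A c p (X p + Y p))"
  proof (rule smooth_fun_on_cong)
    show "smooth_fun_on A (W \<inter> chart_dom A c) (\<lambda>p. components A c p (X p) + components A c p (Y p))"
      using assms by (intro smooth_fun_on_add) (auto simp: smooth_field_on_def)
  qed (use assms in \<open>auto simp: linear_add[OF linear_components]\<close>)
qed

lemma smooth_field_on_scaleR:
  fixes f :: "'a \<Rightarrow> real"
  assumes "open W" "smooth_fun_on A W f" "smooth_field_on A W X"
  shows "smooth_field_on A W (\<lambda>p. f p *\<^sub>R X p)"
  unfolding smooth_field_on_def
proof
  fix c
  show "smooth_fun_on A (W \<inter> chart_dom A c) (\<lambda>p. components A c p (f p *\<^sub>R X p))"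
  proof (rule smooth_fun_on_cong)
    show "smooth_fun_on A (W \<inter> chart_dom A c) (\<lambda>p. f p *\<^sub>R components A c p (X p))"
      using assms by (intro smooth_fun_on_scaleR)
        (auto simp: smooth_field_on_def intro: smooth_fun_on_subset)
  qed (use assms in \<open>auto simp: linear_cmul[OF linear_components]\<close>)
qed

lemma smooth_field_on_zero: "smooth_field_on A W (\<lambda>_. 0)"
  unfolding smooth_field_on_def
proof
  fix c
  have "smooth_on (coord A d ` (W \<inter> chart_dom A c \<inter> chart_dom A d))
      ((\<lambda>p. components A c p 0) \<circ> param A d)" for d
  proof -
    \<comment> \<open>Here \<open>W\<close> is an arbitrary set, so smoothness is first shown on the
      whole overlap of the charts, which is open, and then restricted. Only inside the chart domain
      is \<open>components A c p\<close> known to send 0 to 0.\<close>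
    have "smooth_on (coord A d ` (chart_dom A c \<inter> chart_dom A d)) ((\<lambda>p. components A c p 0) \<circ> param A d)"
      by (rule smooth_on_cong[of _ "\<lambda>_. 0"])
        (auto simp: smooth_on_def Ck_on_const open_coord_image linear_0[OF linear_components])
    then show ?thesis by (rule smooth_on_subset) auto
  qed
  then show "smooth_fun_on A (W \<inter> chart_dom A c) (\<lambda>p. components A c p 0)"
    by (simp add: smooth_fun_on_def)
qed

lemma smooth_field_on_sum:
  "open W \<Longrightarrow> (\<And>i. i \<in> I \<Longrightarrow> smooth_field_on A W (X i)) \<Longrightarrow> smooth_field_on A W (\<lambda>p. \<Sum>i\<in>I. X i p)"
  by (induction I rule: infinite_finite_induct) (auto intro: smooth_field_on_add smooth_field_on_zero)

lemma smooth_field_on_diff: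
  assumes "open W" "smooth_field_on A W X" "smooth_field_on A W Y"
  shows "smooth_field_on A W (\<lambda>p. X p - Y p)"
  using smooth_field_on_add[OF assms(1,2) smooth_field_on_scaleR[OF assms(1) smooth_fun_on_const[of W "-1"] assms(3)]]
  by simp

lemma dir_deriv_locally_const:
  assumes "open W" "p \<in> W" "\<And>q. q \<in> W \<Longrightarrow> f q = c"
  shows "dir_deriv A f p v = 0"
proof -
  have "frechet_derivative (\<lambda>_. c) (at (coord A p p)) =
      frechet_derivative (f \<circ> param A p) (at (coord A p p))"
    using assms
    by (intro frechet_derivative_transform_within_open[of _ _ "coord A p ` (W \<inter> chart_dom A p)"])
      (auto simp: open_coord_image)
  from fun_cong[OF this, of v] show ?thesis by (simp add: dir_deriv_def)
qed

end

section \<open>Orthonormal frames\<close>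

locale riemannian = manifold A
  for A :: "('a::t2_space, 'e::euclidean_space) atlas" +
  fixes g :: "'a \<Rightarrow> 'e \<Rightarrow> 'e \<Rightarrow> real"
  assumes riemannian_metric: "riemannian_metric A g"
begin

lemma bilinear_metric: "bilinear (g p)"
  and metric_sym: "g p u v = g p v u"
  and metric_pos: "v \<noteq> 0 \<Longrightarrow> g p v v > 0"
  and smooth_fun_on_metric:
    "open W \<Longrightarrow> smooth_field_on A W X \<Longrightarrow> smooth_field_on A W Y \<Longrightarrow>
       smooth_fun_on A W (\<lambda>p. g p (X p) (Y p))"
  using riemannian_metric unfolding riemannian_metric_def by blast+

lemmas metric_bilinear_simps =
  bilinear_ladd[OF bilinear_metric] bilinear_radd[OF bilinear_metric]
  bilinear_lmul[OF bilinear_metric] bilinear_rmul[OF bilinear_metric]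
  bilinear_lsub[OF bilinear_metric] bilinear_rsub[OF bilinear_metric]
  bilinear_lzero[OF bilinear_metric] bilinear_rzero[OF bilinear_metric]

lemma metric_sum_left: "g p (\<Sum>i\<in>I. f i) v = (\<Sum>i\<in>I. g p (f i) v)"
  by (induction I rule: infinite_finite_induct) (simp_all add: metric_bilinear_simps)

lemma metric_sum_right: "g p v (\<Sum>i\<in>I. f i) = (\<Sum>i\<in>I. g p v (f i))"
  using metric_sum_left metric_sym by simp

definition orthonormal :: "'a \<Rightarrow> 'i set \<Rightarrow> ('i \<Rightarrow> 'e) \<Rightarrow> bool" where
  "orthonormal p I e \<longleftrightarrow> (\<forall>i\<in>I. \<forall>j\<in>I. g p (e i) (e j) = (if i = j then 1 else 0))"

text \<open>Both sides are linear in \<open>v\<close>, so it is enough to check the vectors of the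
  family themselves.\<close>

lemma orthonormal_expansion:
  assumes "finite I" "orthonormal p I e" "v \<in> span (e ` I)"
  shows "(\<Sum>i\<in>I. g p v (e i) *\<^sub>R e i) = v"
  using assms(3)
proof (induction rule: span_induct)
  case base
  show ?case
    by (auto simp: subspace_def metric_bilinear_simps sum.distrib scaleR_add_left
        simp flip: scaleR_scaleR scaleR_sum_right)
next
  case (step v)
  then obtain j where j: "j \<in> I" "v = e j" by auto
  have "(\<Sum>i\<in>I. g p v (e i) *\<^sub>R e i) = (\<Sum>i\<in>I. if i = j then e j else 0)"
    using assms(2) j by (intro sum.cong) (auto simp: orthonormal_def)
  then show ?case using assms(1) j by simp
qed

text \<open>A member lying in the span of the others would be orthogonal to itself while having
  length 1. Hence the family is independent, and its size gives the full dimension.\<close>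

lemma orthonormal_span_eq_UNIV:
  assumes "finite I" "orthonormal p I e" "card I = DIM('e)"
  shows "span (e ` I) = UNIV"
proof -
  have "inj_on e I"
    using assms(2) unfolding inj_on_def orthonormal_def by (metis zero_neq_one)
  have "independent (e ` I)"
    unfolding dependent_def
  proof (intro notI, elim bexE)
    fix a assume a: "a \<in> e ` I" "a \<in> span (e ` I - {a})"
    have "g p x a = 0" if "x \<in> span (e ` I - {a})" for x
      using that
    proof (induction rule: span_induct)
      case base
      then show ?case by (auto simp: subspace_def metric_bilinear_simps)
    next
      case (step x)
      then show ?case using a(1) assms(2) unfolding orthonormal_def by auto
    qed
    then have "g p a a = 0" using a(2) .
    moreover have "g p a a = 1" using a(1) assms(2) unfolding orthonormal_def by auto
    ultimately show False by simp
  qed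
  then have "dim (e ` I) = DIM('e)"
    using dim_eq_card_independent[of "e ` I"] card_image[OF \<open>inj_on e I\<close>] assms(3) by simp
  then show ?thesis by (simp add: dim_eq_full)
qed

text \<open>Gram-Schmidt, adding one field at a time; the induction descends from a complete frame.
  Each step shrinks the neighbourhood of \<open>q\<close> to the points where the new field does not
  vanish. The given fields are kept as functions, so expressions in them can later be rewritten by
  plain equality.\<close>

lemma extend_orthonormal_frame:
  assumes "l \<le> DIM('e)" "open W" "q \<in> W" "\<And>i. i \<in> {1..l} \<Longrightarrow> smooth_field_on A W (E i)"
    and "\<And>p. p \<in> W \<Longrightarrow> orthonormal p {1..l} (\<lambda>i. E i p)"
  shows "\<exists>V E'. open V \<and> q \<in> V \<and> V \<subseteq> W \<and> (\<forall>i\<in>{1..l}. E' i = E i) \<and>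
    (\<forall>i\<in>{1..DIM('e)}. smooth_field_on A V (E' i)) \<and>
    (\<forall>p\<in>V. orthonormal p {1..DIM('e)} (\<lambda>i. E' i p))"
  using assms
proof (induction l arbitrary: W E rule: inc_induct)
  case base
  then show ?case by blast
next
  case (step l)
  \<comment> \<open>Fewer than \<open>DIM('e)\<close> vectors cannot span the tangent space at
    \<open>q\<close>, which provides a vector \<open>v\<close> to start from.\<close>
  have "dim ((\<lambda>i. E i q) ` {1..l}) \<le> card ((\<lambda>i. E i q) ` {1..l})" by (intro dim_le_card') simp
  also have "\<dots> \<le> l" using card_image_le[of "{1..l}" "\<lambda>i. E i q"] by simp
  finally have "span ((\<lambda>i. E i q) ` {1..l}) \<noteq> UNIV"
    using step.hyps by (metis dim_UNIV dim_span leD)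
  then obtain v where v: "v \<notin> span ((\<lambda>i. E i q) ` {1..l})" by blast
  define U where "U = W \<inter> chart_dom A q"
  define C where "C = coord_field A q v"
  \<comment> \<open>The vector \<open>v\<close> is extended to the coordinate field
    \<open>C\<close>, and \<open>w\<close> is \<open>C\<close> minus its orthogonal projection onto
    the span of the fields found so far. It is nonzero at \<open>q\<close> because \<open>v\<close>
    lies outside their span there.\<close>
  define w where "w p = C p - (\<Sum>i\<in>{1..l}. g p (C p) (E i p) *\<^sub>R E i p)" for p
  have U: "open U" "q \<in> U" "U \<subseteq> W" using step.prems by (auto simp: U_def)
  have C: "smooth_field_on A U C"
    unfolding C_def U_def by (rule smooth_field_on_subset[OF smooth_field_on_coord_field]) simp
  have E: "smooth_field_on A U (E i)" if "i \<in> {1..l}" for i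
    using smooth_field_on_subset[OF step.prems(3)[OF that] U(3)] .
  have w: "smooth_field_on A U w"
    unfolding w_def
    by (intro smooth_field_on_diff smooth_field_on_sum smooth_field_on_scaleR smooth_fun_on_metric U C E)
  have wE: "g p (w p) (E j p) = 0" if "p \<in> U" "j \<in> {1..l}" for p j
  proof -
    have "(\<Sum>i\<in>{1..l}. g p (C p) (E i p) * g p (E i p) (E j p)) =
        (\<Sum>i\<in>{1..l}. if i = j then g p (C p) (E j p) else 0)"
      using step.prems(4)[of p] U that by (intro sum.cong) (auto simp: orthonormal_def)
    then show ?thesis using that by (simp add: w_def metric_bilinear_simps metric_sum_left)
  qed
  have "w q \<noteq> 0"
  proof
    assume "w q = 0"
    then have "v = (\<Sum>i\<in>{1..l}. g q v (E i q) *\<^sub>R E i q)" by (simp add: w_def C_def)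
    also have "\<dots> \<in> span ((\<lambda>i. E i q) ` {1..l})"
      by (intro span_sum span_scale span_base) auto
    finally show False using v by simp
  qed
  define N where "N p = g p (w p) (w p)" for p
  have N: "smooth_fun_on A U N"
    unfolding N_def[abs_def] by (intro smooth_fun_on_metric U w)
  define V where "V = {p \<in> U. N p > 0}"
  have V: "open V" "q \<in> V" "V \<subseteq> U"
  proof -
    have "open (U \<inter> N -` {0<..})"
      by (intro continuous_open_preimage smooth_fun_on_continuous N U) simp
    moreover have "U \<inter> N -` {0<..} = V" by (auto simp: V_def)
    ultimately show "open V" by simp
    show "q \<in> V" "V \<subseteq> U" using U(2) metric_pos[OF \<open>w q \<noteq> 0\<close>] by (auto simp: V_def N_def)
  qed
  define e where "e p = (N p powr (-1/2)) *\<^sub>R w p" for p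
  have e: "smooth_field_on A V e"
    unfolding e_def
    using smooth_fun_on_subset[OF N V(3)] smooth_field_on_subset[OF w V(3)] V
    by (intro smooth_field_on_scaleR smooth_fun_on_powr) (auto simp: V_def)
  have ee: "g p (e p) (e p) = 1" if "p \<in> V" for p
  proof -
    have "N p > 0" using that by (simp add: V_def)
    \<comment> \<open>The three exponents add up to 0, so the squared length of \<open>e p\<close>
      is \<open>N p powr 0\<close>, which is 1 because \<open>N p\<close> is positive.\<close>
    then have "N p powr (-1/2) * (N p powr (-1/2) * N p) = N p powr (-1/2 + -1/2 + 1)"
      by (simp only: powr_add) simp
    then show ?thesis using \<open>N p > 0\<close> by (simp add: e_def metric_bilinear_simps flip: N_def)
  qed
  have eE: "g p (e p) (E j p) = 0" "g p (E j p) (e p) = 0" if "p \<in> V" "j \<in> {1..l}" for p j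
    using wE[of p j] V that metric_sym[of p "w p"] by (auto simp: e_def metric_bilinear_simps)
  define E1 where "E1 = E(Suc l := e)"
  have "smooth_field_on A V (E1 i)" if "i \<in> {1..Suc l}" for i
    using that e E V smooth_field_on_subset[of U "E i" V] by (cases "i = Suc l") (auto simp: E1_def)
  moreover have "orthonormal p {1..Suc l} (\<lambda>i. E1 i p)" if "p \<in> V" for p
  proof -
    have "orthonormal p {1..l} (\<lambda>i. E i p)" using step.prems(4) that V U by blast
    then show ?thesis
      using ee[OF that] eE[OF that]
      by (auto simp: orthonormal_def E1_def le_Suc_eq atLeastAtMostSuc_conv)
  qed
  ultimately obtain V' E' where V': "open V'" "q \<in> V'" "V' \<subseteq> V" "\<forall>i\<in>{1..Suc l}. E' i = E1 i"
    "\<forall>i\<in>{1..DIM('e)}. smooth_field_on A V' (E' i)"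
    "\<forall>p\<in>V'. orthonormal p {1..DIM('e)} (\<lambda>i. E' i p)"
    using step.IH[of V E1] V by blast
  have "V' \<subseteq> W" "\<forall>i\<in>{1..l}. E' i = E i" using V V' U by (auto simp: E1_def)
  with V' show ?case by (intro exI[of _ V'] exI[of _ E'] conjI)
qed

end

section \<open>The Levi-Civita connection in an orthonormal frame\<close>

locale levi_civita_manifold = riemannian A g
  for A :: "('a::t2_space, 'e::euclidean_space) atlas" and g :: "'a \<Rightarrow> 'e \<Rightarrow> 'e \<Rightarrow> real" +
  fixes nab :: "('a \<Rightarrow> 'e) \<Rightarrow> ('a \<Rightarrow> 'e) \<Rightarrow> 'a \<Rightarrow> 'e"
  assumes levi_civita: "levi_civita A g nab"
begin

section \<open>Calculation rules for the Levi-Civita connection\<close>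

lemma affine_connection: "affine_connection A nab"
  using levi_civita by (simp add: levi_civita_def)

context
  fixes W X Y
  assumes W: "open W" and X: "smooth_field_on A W X" and Y: "smooth_field_on A W Y"
begin

lemmas connection_rules = affine_connection[unfolded affine_connection_def, rule_format, OF W X Y]

lemmas levi_civita_rules =
  conjunct2[OF levi_civita[unfolded levi_civita_def], rule_format, OF W X Y]

lemma smooth_field_on_nab: "smooth_field_on A W (nab X Y)"
  using connection_rules by blast

lemma nab_cong:
  "(\<And>p. p \<in> W \<Longrightarrow> X' p = X p) \<Longrightarrow> (\<And>p. p \<in> W \<Longrightarrow> Y' p = Y p) \<Longrightarrow> p \<in> W \<Longrightarrow> nab X' Y' p = nab X Y p"
  using connection_rules by blast

lemma nab_add_left:
  "smooth_field_on A W Z \<Longrightarrow> p \<in> W \<Longrightarrow> nab (\<lambda>q. X q + Z q) Y p = nab X Y p + nab Z Y p"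
  using connection_rules by blast

lemma nab_scaleR_left:
  fixes f :: "'a \<Rightarrow> real"
  shows "smooth_fun_on A W f \<Longrightarrow> p \<in> W \<Longrightarrow> nab (\<lambda>q. f q *\<^sub>R X q) Y p = f p *\<^sub>R nab X Y p"
  using connection_rules by blast

lemma nab_torsion: "p \<in> W \<Longrightarrow> lie_bracket A X Y p = nab X Y p - nab Y X p"
  using levi_civita_rules by simp

lemma nab_metric:
  "smooth_field_on A W Z \<Longrightarrow> p \<in> W \<Longrightarrow> dir_deriv A (\<lambda>q. g q (Y q) (Z q)) p (X p) =
     g p (nab X Y p) (Z p) + g p (Y p) (nab X Z p)"
  using levi_civita_rules by blast

text \<open>Metric compatibility applied to a locally constant inner product, whose derivative
  vanishes. This is the way a covariant derivative is moved from one factor to the other in all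
  orthogonality arguments below.\<close>

lemma nab_skew:
  assumes "smooth_field_on A W Z" "p \<in> W" "\<And>q. q \<in> W \<Longrightarrow> g q (Y q) (Z q) = c"
  shows "g p (nab X Y p) (Z p) = - g p (Y p) (nab X Z p)"
  using nab_metric[OF assms(1,2)] dir_deriv_locally_const[OF W assms(2,3)] by simp

lemma nab_zero_left: "p \<in> W \<Longrightarrow> nab (\<lambda>_. 0) Y p = 0"
  using nab_scaleR_left[OF smooth_fun_on_const, of p 0] by simp

end

text \<open>By vanishing torsion the bracket is a difference of two covariant derivatives, which are
  smooth by the axioms of a connection.\<close>

lemma smooth_field_on_lie_bracket:
  assumes "open W" "smooth_field_on A W X" "smooth_field_on A W Y"
  shows "smooth_field_on A W (lie_bracket A X Y)"
proof (rule smooth_field_on_cong)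
  show "smooth_field_on A W (\<lambda>p. nab X Y p - nab Y X p)"
    using assms by (intro smooth_field_on_diff smooth_field_on_nab)
qed (use assms nab_torsion in auto)

lemma nab_sum_left:
  assumes "open W" "\<And>i. i \<in> I \<Longrightarrow> smooth_field_on A W (X i)" "smooth_field_on A W Y" "p \<in> W"
  shows "nab (\<lambda>q. \<Sum>i\<in>I. X i q) Y p = (\<Sum>i\<in>I. nab (X i) Y p)"
  using assms(2)
  by (induction I rule: infinite_finite_induct)
    (simp_all add: assms nab_zero_left[OF assms(1,3,3)]
      nab_add_left[OF assms(1) _ assms(3)] smooth_field_on_sum)

text \<open>Metric compatibility gives \<open>2 * g p (nab Z X p) (X p)\<close> for the derivative
  term. Writing the bracket of \<open>Z\<close> and \<open>X\<close> as
  \<open>nab Z X - nab X Z\<close> cancels it and leaves the derivative of \<open>Z\<close> along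
  \<open>X\<close>.\<close>

lemma lie_deriv_metric_diag:
  assumes "open W" "smooth_field_on A W Z" "smooth_field_on A W X" "p \<in> W"
  shows "lie_deriv_metric A g Z X X p = 2 * g p (nab X Z p) (X p)"
  unfolding lie_deriv_metric_def
  using nab_metric[OF assms(1-3,3,4)] nab_torsion[OF assms] metric_sym[of p "X p"]
  by (simp add: metric_bilinear_simps)

end

locale orthonormal_frame = levi_civita_manifold A g nab
  for A :: "('a::t2_space, 'e::euclidean_space) atlas" and g nab +
  fixes U :: "'a set" and I :: "'i set" and e :: "'i \<Rightarrow> 'a \<Rightarrow> 'e"
  assumes open_U: "open U" and finite_I: "finite I" and card_I: "card I = DIM('e)"
    and smooth_frame: "i \<in> I \<Longrightarrow> smooth_field_on A U (e i)"
    and orthonormal_frame: "p \<in> U \<Longrightarrow> orthonormal p I (\<lambda>i. e i p)"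
begin

lemma frame_expansion: "p \<in> U \<Longrightarrow> (\<Sum>i\<in>I. g p v (e i p) *\<^sub>R e i p) = v"
  using orthonormal_expansion[OF finite_I orthonormal_frame]
    orthonormal_span_eq_UNIV[OF finite_I orthonormal_frame card_I] by simp

lemma metric_expansion: "p \<in> U \<Longrightarrow> g p u v = (\<Sum>i\<in>I. g p u (e i p) * g p v (e i p))"
proof -
  assume "p \<in> U"
  then have "g p u v = g p u (\<Sum>i\<in>I. g p v (e i p) *\<^sub>R e i p)" by (simp add: frame_expansion)
  then show ?thesis by (simp add: metric_sum_right metric_bilinear_simps mult.commute)
qed

text \<open>Tensoriality in the first argument: \<open>B\<close> is expanded with smooth
  coefficients, which then come out of the connection. The smaller set \<open>V\<close> admits
  fields smooth only on a part of \<open>U\<close>, such as coordinate fields.\<close>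

lemma nab_frame_expansion:
  assumes "open V" "V \<subseteq> U" "smooth_field_on A V B" "smooth_field_on A V Y" "p \<in> V"
  shows "nab B Y p = (\<Sum>i\<in>I. g p (B p) (e i p) *\<^sub>R nab (e i) Y p)"
proof -
  have e: "smooth_field_on A V (e i)" if "i \<in> I" for i
    using smooth_field_on_subset[OF smooth_frame[OF that] assms(2)] .
  have f: "smooth_fun_on A V (\<lambda>q. g q (B q) (e i q))" if "i \<in> I" for i
    by (intro smooth_fun_on_metric assms e that)
  have "nab B Y p = nab (\<lambda>q. \<Sum>i\<in>I. g q (B q) (e i q) *\<^sub>R e i q) Y p"
    using assms frame_expansion
    by (intro nab_cong[of V] smooth_field_on_sum smooth_field_on_scaleR f e) auto
  also have "\<dots> = (\<Sum>i\<in>I. nab (\<lambda>q. g q (B q) (e i q) *\<^sub>R e i q) Y p)"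
    by (intro nab_sum_left[of V] smooth_field_on_scaleR f e assms)
  also have "\<dots> = (\<Sum>i\<in>I. g p (B p) (e i p) *\<^sub>R nab (e i) Y p)"
    by (intro sum.cong refl nab_scaleR_left[of V] f e assms)
  finally show ?thesis .
qed

lemma nab_pointwise_left:
  assumes "open V" "V \<subseteq> U" "smooth_field_on A V B" "smooth_field_on A V C" "smooth_field_on A V Y"
    and "p \<in> V" "B p = C p"
  shows "nab B Y p = nab C Y p"
  by (simp add: nab_frame_expansion[OF assms(1,2,3,5,6)] nab_frame_expansion[OF assms(1,2,4,5,6)] assms(7))

end

text \<open>The fields indexed by \<open>K\<close> span a distribution and those indexed by
  \<open>J\<close> its orthogonal complement; \<open>parallel\<close> expresses in frame components
  that covariant differentiation preserves the distribution.\<close>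

locale split_orthonormal_frame = orthonormal_frame A g nab U I e
  for A :: "('a::t2_space, 'e::euclidean_space) atlas" and g nab U and I :: "'i set" and e +
  fixes K J :: "'i set"
  assumes I_split: "I = K \<union> J" and disjoint: "K \<inter> J = {}"
    and parallel: "\<lbrakk>p \<in> U; a \<in> I; k \<in> K; j \<in> J\<rbrakk> \<Longrightarrow> g p (nab (e a) (e k) p) (e j p) = 0"
begin

lemma frame_orth:
  assumes "p \<in> U" "k \<in> K" "j \<in> J"
  shows "g p (e k p) (e j p) = 0"
proof -
  have "k \<noteq> j" using assms disjoint by auto
  then show ?thesis using orthonormal_frame[OF assms(1)] assms I_split unfolding orthonormal_def by auto
qed

lemma parallel_K:
  assumes "p \<in> U" "smooth_field_on A U B" "k \<in> K" "j \<in> J"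
  shows "g p (nab B (e k) p) (e j p) = 0"
proof -
  have k: "k \<in> I" using assms I_split by auto
  show ?thesis
    unfolding nab_frame_expansion[OF open_U order_refl assms(2) smooth_frame[OF k] assms(1)]
    using assms by (simp add: parallel metric_sum_left metric_bilinear_simps)
qed

lemma parallel_J:
  assumes "p \<in> U" "smooth_field_on A U B" "k \<in> K" "j \<in> J"
  shows "g p (nab B (e j) p) (e k p) = 0"
proof -
  have "g p (nab B (e k) p) (e j p) = - g p (e k p) (nab B (e j) p)"
    using assms I_split frame_orth by (intro nab_skew[OF open_U]) (auto simp: smooth_frame)
  then show ?thesis using parallel_K[OF assms] metric_sym by simp
qed

text \<open>In the frame expansion of \<open>g p u v\<close> every summand has a vanishing factor:
  the one from \<open>u\<close> for indices in \<open>J\<close>, the one from \<open>v\<close> for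
  indices in \<open>K\<close>.\<close>

lemma metric_split:
  assumes "p \<in> U" "\<And>j. j \<in> J \<Longrightarrow> g p u (e j p) = 0" "\<And>k. k \<in> K \<Longrightarrow> g p v (e k p) = 0"
  shows "g p u v = 0"
  using assms(2,3) I_split by (subst metric_expansion[OF assms(1)]) (auto intro!: sum.neutral)

text \<open>Extends \<open>parallel_K\<close> from frame fields to all sections of the span of the
  \<open>K\<close> fields, so that it can be applied to second covariant derivatives. The derivative
  is moved onto \<open>e j\<close>, where \<open>parallel_J\<close> applies.\<close>

lemma parallel_section_K:
  assumes "p \<in> U" "smooth_field_on A U B" "smooth_field_on A U Y" "j \<in> J"
    and "\<And>q i. q \<in> U \<Longrightarrow> i \<in> J \<Longrightarrow> g q (Y q) (e i q) = 0"
  shows "g p (nab B Y p) (e j p) = 0"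
proof -
  have "g p (nab B Y p) (e j p) = - g p (Y p) (nab B (e j) p)"
    using assms I_split by (intro nab_skew[OF open_U]) (auto simp: smooth_frame)
  also have "g p (Y p) (nab B (e j) p) = 0"
    by (rule metric_split) (use assms parallel_J in auto)
  finally show ?thesis by simp
qed

text \<open>Each of the three terms of the curvature is a covariant derivative of a section of the
  span of the \<open>K\<close> fields, hence orthogonal to \<open>e j\<close>.\<close>

lemma mixed_curvature_eq_0:
  assumes "p \<in> U" "k \<in> K" "j \<in> J"
  shows "g p (curvature A nab (e j) (e k) (e k) p) (e j p) = 0"
proof -
  have I: "k \<in> I" "j \<in> I" using assms I_split by auto
  note sm = open_U smooth_frame[OF I(1)] smooth_frame[OF I(2)]
  have "g p (nab (e j) (nab (e k) (e k)) p) (e j p) = 0"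
    "g p (nab (e k) (nab (e j) (e k)) p) (e j p) = 0"
    using assms sm by (auto intro!: parallel_section_K smooth_field_on_nab frame_orth)
  moreover have "g p (nab (lie_bracket A (e j) (e k)) (e k) p) (e j p) = 0"
    using assms sm by (intro parallel_K smooth_field_on_lie_bracket)
  ultimately show ?thesis by (simp add: curvature_def metric_bilinear_simps)
qed

lemma lie_deriv_metric_eq_0:
  assumes "p \<in> U" "k \<in> K" "smooth_field_on A U Z" "\<And>q i. q \<in> U \<Longrightarrow> i \<in> K \<Longrightarrow> g q (Z q) (e i q) = 0"
  shows "lie_deriv_metric A g Z (e k) (e k) p = 0"
proof -
  have k: "smooth_field_on A U (e k)" using assms I_split by (simp add: smooth_frame)
  have "g p (nab (e k) Z p) (e k p) = - g p (Z p) (nab (e k) (e k) p)"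
    using assms k by (intro nab_skew[OF open_U]) auto
  also have "g p (nab (e k) (e k) p) (Z p) = 0"
    by (rule metric_split) (use assms k parallel_K in auto)
  then have "g p (Z p) (nab (e k) (e k) p) = 0" by (metis metric_sym)
  finally show ?thesis using lie_deriv_metric_diag[OF open_U assms(3) k assms(1)] by simp
qed

text \<open>The vanishing mixed curvatures reduce the Ricci sum from \<open>I\<close> to
  \<open>K\<close>, and the Lie derivative term is zero, so each \<open>k\<close> contributes
  \<open>- lam\<close>. The metric term of the soliton equation appears as \<open>lam\<close> alone
  because it is evaluated on a unit vector.\<close>

lemma scalar_curv_K:
  assumes "p \<in> U" "smooth_field_on A U Z" "\<And>q i. q \<in> U \<Longrightarrow> i \<in> K \<Longrightarrow> g q (Z q) (e i q) = 0"
    and soliton: "\<And>k. k \<in> K \<Longrightarrow> 1/2 * lie_deriv_metric A g Z (e k) (e k) p +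
        (\<Sum>i\<in>I. g p (curvature A nab (e i) (e k) (e k) p) (e i p)) + lam = 0"
  shows "(\<Sum>k\<in>K. \<Sum>i\<in>K. g p (curvature A nab (e i) (e k) (e k) p) (e i p)) = - lam * real (card K)"
proof -
  have "(\<Sum>i\<in>K. g p (curvature A nab (e i) (e k) (e k) p) (e i p)) = - lam" if k: "k \<in> K" for k
  proof -
    have "(\<Sum>i\<in>I. g p (curvature A nab (e i) (e k) (e k) p) (e i p)) =
        (\<Sum>i\<in>K. g p (curvature A nab (e i) (e k) (e k) p) (e i p))"
      using finite_I I_split disjoint mixed_curvature_eq_0[OF assms(1) k]
      by (intro sum.mono_neutral_right) auto
    then show ?thesis using soliton[OF k] lie_deriv_metric_eq_0[OF assms(1) k assms(2,3)] by simp
  qed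
  then show ?thesis by simp
qed

end

section \<open>The range of a totally geodesic map\<close>

locale smooth_manifold_map = M: manifold M + N: levi_civita_manifold N gN nabN
  for M :: "('a::t2_space, 'e::euclidean_space) atlas"
    and N :: "('b::t2_space, 'f::euclidean_space) atlas" and gN nabN +
  fixes F :: "'a \<Rightarrow> 'b"
  assumes smooth_map: "smooth_map M N F"
begin

lemma open_vimage: "open W \<Longrightarrow> open (F -` W)"
  using smooth_map continuous_on_open_vimage[of UNIV F] by (simp add: smooth_map_def)

lemma smooth_local_map:
  "smooth_on (coord M c ` (F -` chart_dom N d \<inter> chart_dom M c)) (coord N d \<circ> F \<circ> param M c)"
  using smooth_map unfolding smooth_map_def smooth_fun_on_def by blast

lemma local_map_differentiable:
  assumes "p \<in> chart_dom M c" "F p \<in> chart_dom N d"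
  shows "(coord N d \<circ> F \<circ> param M c) differentiable (at (coord M c p))"
  using assms by (intro smooth_on_differentiable[OF smooth_local_map]) auto

text \<open>The chain rule in the charts centred at \<open>p\<close> and \<open>F p\<close>. The
  coordinate expressions of the two sides agree near \<open>p\<close>, namely where \<open>F\<close>
  takes values in the chart around \<open>F p\<close>.\<close>

lemma dir_deriv_compose_map:
  assumes "smooth_fun_on N W h" "open W" "F p \<in> W"
  shows "dir_deriv M (h \<circ> F) p v = dir_deriv N h (F p) (pushforward M N F p v)"
proof -
  let ?c = "F p" and ?x = "coord M p p"
  let ?G = "coord N ?c \<circ> F \<circ> param M p"
  have Gx: "?G ?x = coord N ?c ?c" by simp
  have dG: "?G differentiable (at ?x)" by (intro local_map_differentiable) simp_all
  have dh: "(h \<circ> param N ?c) differentiable (at (?G ?x))"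
    unfolding Gx by (rule N.smooth_fun_on_differentiable[OF assms(1,3)]) simp
  have eq: "frechet_derivative ((h \<circ> param N ?c) \<circ> ?G) (at ?x) = frechet_derivative (h \<circ> F \<circ> param M p) (at ?x)"
  proof (rule frechet_derivative_transform_within_open)
    show "((h \<circ> param N ?c) \<circ> ?G) differentiable (at ?x)"
      by (rule differentiable_chain_at[OF dG dh])
    show "open (coord M p ` (F -` chart_dom N ?c \<inter> chart_dom M p))"
      by (intro M.open_coord_image open_vimage) simp
  qed auto
  then show ?thesis
    unfolding dir_deriv_def pushforward_def o_assoc
      trans[OF eq[symmetric] frechet_derivative_compose[OF dG dh], unfolded Gx o_assoc]
    by (simp only: comp_apply)
qed

text \<open>Identifies the components of the pushed-forward field with a directional derivative of
  the local expression of \<open>F\<close>; this makes them differentiable functions on the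
  source.\<close>

lemma components_pushforward_coord_field:
  assumes "q \<in> chart_dom M c" "F q \<in> chart_dom N d"
  shows "components N d (F q) (pushforward M N F q (coord_field M c v q)) =
    frechet_derivative (coord N d \<circ> F \<circ> param M c) (at (coord M c q)) v"
proof -
  let ?x = "coord M q q"
  let ?G = "coord N (F q) \<circ> F \<circ> param M q"
  have "components N d (F q) (pushforward M N F q w) = dir_deriv M (coord N d \<circ> F) q w" for w
    unfolding components_def
    by (rule dir_deriv_compose_map[symmetric, OF N.smooth_fun_on_coord]) (use assms in simp_all)
  then show ?thesis
    unfolding dir_deriv_def coord_field_def
    using assms
    by (simp add: M.frechet_derivative_change_chart[OF assms(1) M.center_in_chart, of "coord N d \<circ> F" v]
        local_map_differentiable)
qed

text \<open>
  Metric compatibility of the pullback connection: along \<open>F\<close>, the section \<open>F\<^sub>*V\<close> is expanded in a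
  coordinate frame of \<open>N\<close>, so that the vanishing of \<open>gN (F\<^sub>*V) (Z \<circ> F)\<close> can be differentiated without
  extending \<open>F\<^sub>*V\<close> to a field on \<open>N\<close>.
\<close>

lemma pullback_connection_metric:
  assumes "open W" "F p \<in> W" "smooth_field_on N W Z"
    and orth: "\<And>q w. F q \<in> W \<Longrightarrow> gN (F q) (pushforward M N F q w) (Z (F q)) = 0"
    and w: "w = X p"
  shows "gN (F p) (pullback_connection M N nabN F X
      (\<lambda>q. pushforward M N F q (coord_field M p v q)) p) (Z (F p)) =
    - gN (F p) (pushforward M N F p v) (nabN (coord_field N (F p) (pushforward M N F p w)) Z (F p))"
proof -
  let ?c = "F p" and ?x = "coord M p p"
  let ?C = "coord_field N ?c (pushforward M N F p w)"
  define V where "V = W \<inter> chart_dom N ?c"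
  have V: "open V" "?c \<in> V" "V \<subseteq> W" using assms by (auto simp: V_def)
  have Z: "smooth_field_on N V Z" using N.smooth_field_on_subset[OF assms(3) V(3)] .
  have cf: "smooth_field_on N V (coord_field N ?c b)" for b
    by (rule N.smooth_field_on_subset[OF N.smooth_field_on_coord_field]) (simp add: V_def)
  define h where "h b y = gN y (coord_field N ?c b y) (Z y)" for b y
  have h: "smooth_fun_on N V (h b)" for b
    unfolding h_def[abs_def] by (intro N.smooth_fun_on_metric V cf Z)
  define P where "P = F -` V \<inter> chart_dom M p"
  have P: "open P" "p \<in> P" using V open_vimage by (auto simp: P_def)
  define s where "s q = components N ?c (F q) (pushforward M N F q (coord_field M p v q))" for q
  define S where "S = s \<circ> param M p"
  have oP: "open (coord M p ` P)"
    unfolding P_def by (intro M.open_coord_image open_vimage V)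
  have xP: "?x \<in> coord M p ` P" using P by simp
  have dS: "S differentiable (at ?x)"
  proof (rule differentiable_transform_open[OF _ oP xP])
    show "(\<lambda>x. frechet_derivative (coord N ?c \<circ> F \<circ> param M p) (at x) v) differentiable (at ?x)"
      by (rule smooth_on_differentiable[OF smooth_on_frechet_derivative[OF smooth_local_map]]) auto
    show "frechet_derivative (coord N ?c \<circ> F \<circ> param M p) (at y) v = S y" if "y \<in> coord M p ` P" for y
      using that by (auto simp: P_def V_def S_def s_def components_pushforward_coord_field)
  qed
  have dh: "(h b \<circ> F \<circ> param M p) differentiable (at ?x)" for b
  proof -
    let ?G = "coord N ?c \<circ> F \<circ> param M p"
    have Gx: "?G ?x = coord N ?c ?c" by simp
    have "((h b \<circ> param N ?c) \<circ> ?G) differentiable (at ?x)"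
    proof (rule differentiable_chain_at)
      show "?G differentiable (at ?x)" by (intro local_map_differentiable) simp_all
      show "(h b \<circ> param N ?c) differentiable (at (?G ?x))"
        unfolding Gx by (rule N.smooth_fun_on_differentiable[OF h V(2)]) simp
    qed
    then show ?thesis
      by (rule differentiable_transform_open[OF _ oP xP]) (auto simp: P_def V_def)
  qed
  \<comment> \<open>The orthogonality hypothesis in coordinates. It holds throughout a neighbourhood
    of the base point, so it may be differentiated.\<close>
  have sum0: "(\<Sum>b\<in>Basis. (S x \<bullet> b) * h b (F (param M p x))) = 0" if "x \<in> coord M p ` P" for x
  proof -
    from that obtain q where q: "q \<in> P" "x = coord M p q" by blast
    then have qM: "q \<in> chart_dom M p" and FqV: "F q \<in> V" by (auto simp: P_def)
    then have FqN: "F q \<in> chart_dom N ?c" by (simp add: V_def)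
    have "pushforward M N F q (coord_field M p v q) = coord_field N ?c (s q) (F q)"
      by (simp add: s_def N.coord_field_components[OF FqN])
    also have "\<dots> = coord_field N ?c (\<Sum>b\<in>Basis. (s q \<bullet> b) *\<^sub>R b) (F q)"
      by (simp add: euclidean_representation)
    also have "\<dots> = (\<Sum>b\<in>Basis. (s q \<bullet> b) *\<^sub>R coord_field N ?c b (F q))"
      by (simp only: linear_sum[OF N.linear_coord_field[OF FqN]] linear_cmul[OF N.linear_coord_field[OF FqN]])
    finally have "gN (F q) (pushforward M N F q (coord_field M p v q)) (Z (F q)) =
        (\<Sum>b\<in>Basis. (s q \<bullet> b) * h b (F q))"
      by (simp add: N.metric_sum_left N.metric_bilinear_simps h_def)
    then show ?thesis using orth[of q] FqV V q qM by (auto simp: S_def)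
  qed
  \<comment> \<open>The same sum is differentiated twice, by the product rule and as a function
    vanishing near the base point; uniqueness of the derivative then gives \<open>D\<close>.\<close>
  have "((\<lambda>x. \<Sum>b\<in>Basis. (S x \<bullet> b) * h b (F (param M p x))) has_derivative
      (\<lambda>u. \<Sum>b\<in>Basis. (S ?x \<bullet> b) * frechet_derivative (h b \<circ> F \<circ> param M p) (at ?x) u +
        (frechet_derivative S (at ?x) u \<bullet> b) * h b (F (param M p ?x)))) (at ?x)"
    using dS dh
    by (intro has_derivative_sum has_derivative_mult has_derivative_inner_left)
      (simp_all add: frechet_derivative_works o_def)
  moreover have "((\<lambda>x. \<Sum>b\<in>Basis. (S x \<bullet> b) * h b (F (param M p x))) has_derivative (\<lambda>_. 0)) (at ?x)"
    by (rule has_derivative_transform_within_open[OF has_derivative_const oP xP]) (simp add: sum0)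
  ultimately have D: "(\<Sum>b\<in>Basis. (S ?x \<bullet> b) * frechet_derivative (h b \<circ> F \<circ> param M p) (at ?x) w +
        (frechet_derivative S (at ?x) w \<bullet> b) * h b (F (param M p ?x))) = 0"
    using has_derivative_unique by (metis (no_types, lifting))
  have Sx: "S ?x = pushforward M N F p v" by (simp add: S_def s_def)
  \<comment> \<open>The derivative of \<open>h b \<circ> F\<close> along \<open>w\<close> is that of
    \<open>h b\<close> along the pushforward of \<open>w\<close>, the value of \<open>?C\<close> at
    \<open>F p\<close>. There metric compatibility on \<open>N\<close> applies to honest
    fields.\<close>
  have dhb: "frechet_derivative (h b \<circ> F \<circ> param M p) (at ?x) w =
      gN ?c (nabN ?C (coord_field N ?c b) ?c) (Z ?c) + gN ?c b (nabN ?C Z ?c)" for b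
  proof -
    have "frechet_derivative (h b \<circ> F \<circ> param M p) (at ?x) w = dir_deriv N (h b) ?c (?C ?c)"
      using dir_deriv_compose_map[OF h V(1,2), of b w] by (simp add: dir_deriv_def)
    also have "\<dots> = gN ?c (nabN ?C (coord_field N ?c b) ?c) (Z ?c) + gN ?c b (nabN ?C Z ?c)"
      using N.nab_metric[OF V(1) cf cf Z V(2)] by (simp add: h_def[abs_def])
    finally show ?thesis .
  qed
  have repr: "gN ?c u y = (\<Sum>b\<in>Basis. (u \<bullet> b) * gN ?c b y)" for u y
  proof -
    have "gN ?c u y = gN ?c (\<Sum>b\<in>Basis. (u \<bullet> b) *\<^sub>R b) y" by (simp add: euclidean_representation)
    then show ?thesis by (simp add: N.metric_sum_left N.metric_bilinear_simps)
  qed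
  have "gN ?c (pullback_connection M N nabN F X (\<lambda>q. pushforward M N F q (coord_field M p v q)) p) (Z ?c) =
      gN ?c (frechet_derivative S (at ?x) w) (Z ?c) +
      (\<Sum>b\<in>Basis. (S ?x \<bullet> b) * gN ?c (nabN ?C (coord_field N ?c b) ?c) (Z ?c))"
    by (simp add: pullback_connection_def dir_deriv_def w N.metric_bilinear_simps N.metric_sum_left
        Sx S_def s_def[abs_def])
  moreover have "gN ?c (frechet_derivative S (at ?x) w) (Z ?c) =
      (\<Sum>b\<in>Basis. (frechet_derivative S (at ?x) w \<bullet> b) * h b (F (param M p ?x)))"
    by (subst repr) (simp add: h_def)
  moreover have "gN ?c (S ?x) (nabN ?C Z ?c) = (\<Sum>b\<in>Basis. (S ?x \<bullet> b) * gN ?c b (nabN ?C Z ?c))"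
    by (rule repr)
  \<comment> \<open>The derivative of \<open>S\<close> and the derivatives of the coordinate fields
    assemble into the pullback connection; what remains is the term with the derivative of
    \<open>Z\<close>.\<close>
  ultimately show ?thesis
    using D unfolding dhb Sx by (simp add: sum.distrib distrib_left)
qed

text \<open>When the second fundamental form vanishes, the pullback derivative of a pushed-forward
  field is itself a pushforward and so orthogonal to \<open>Z\<close>. By
  \<open>pullback_connection_metric\<close> the derivative of \<open>Z\<close> along the range then
  has no component in the range.\<close>

lemma totally_geodesic_map_normal:
  assumes "open W" "F p \<in> W" "smooth_field_on N W Z"
    and orth: "\<And>q w. F q \<in> W \<Longrightarrow> gN (F q) (pushforward M N F q w) (Z (F q)) = 0"
    and tg: "totally_geodesic_map M nabM N nabN F"
  shows "gN (F p) (pushforward M N F p v)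
    (nabN (coord_field N (F p) (pushforward M N F p w)) Z (F p)) = 0"
proof -
  let ?X = "coord_field M p w" and ?V = "coord_field M p v"
  have "second_fundamental_form M nabM N nabN F ?X ?V p = 0"
    using tg M.open_chart_dom M.smooth_field_on_coord_field M.center_in_chart
    unfolding totally_geodesic_map_def by blast
  then have "pullback_connection M N nabN F ?X (\<lambda>q. pushforward M N F q (?V q)) p =
      pushforward M N F p (nabM ?X ?V p)"
    by (simp add: second_fundamental_form_def)
  then show ?thesis
    using pullback_connection_metric[OF assms(1-4), of w ?X v] orth[OF assms(2)] by simp
qed

end

theorem theorem4p3:
  fixes M :: "('a::t2_space, 'e::euclidean_space) atlas"
    and N :: "('b::t2_space, 'f::euclidean_space) atlas"
    and gM :: "'a \<Rightarrow> 'e \<Rightarrow> 'e \<Rightarrow> real"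
    and gN :: "'b \<Rightarrow> 'f \<Rightarrow> 'f \<Rightarrow> real"
    and nabM :: "('a \<Rightarrow> 'e) \<Rightarrow> ('a \<Rightarrow> 'e) \<Rightarrow> 'a \<Rightarrow> 'e"
    and nabN :: "('b \<Rightarrow> 'f) \<Rightarrow> ('b \<Rightarrow> 'f) \<Rightarrow> 'b \<Rightarrow> 'f"
    and F :: "'a \<Rightarrow> 'b"
    and D :: "'b \<Rightarrow> 'f set"
    and xi :: "'b \<Rightarrow> 'f"
    and lam :: real
    and m r :: nat
  assumes "riemannian_manifold M gM" and "levi_civita M gM nabM"
    and "riemannian_manifold N gN" and "levi_civita N gN nabN"
    and "m = DIM('e)" 
    and "riemannian_map M gM N gN F"
    and "\<forall>p. dim (ker_push M N F p) = r"
    and "range_distribution M N F (m - r) D"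
    and "totally_geodesic_map M nabM N nabN F"
    and "totally_geodesic_distribution_at N nabN D (- closure (range F))"
    and "totally_geodesic_distribution_at N nabN (orth_compl gN D) UNIV"
    and "ricci_soliton N gN nabN xi lam"
    and "section_on N (orth_compl gN D) UNIV xi"
  shows "\<forall>W E. local_orthonormal_frame N gN D W {r+1..m} E \<longrightarrow>
           (\<forall>q\<in>W. scalar_curv N gN nabN {r+1..m} E q = - lam * real (m - r))"
proof (intro allI impI ballI)
  fix W E q
  assume frame: "local_orthonormal_frame N gN D W {r+1..m} E" and qW: "q \<in> W"
  interpret smooth_manifold_map M N gN nabN F
    using assms(1,3,4,6)
    by unfold_locales (auto simp: riemannian_manifold_def riemannian_map_def)

  \<comment> \<open>An orthonormal frame of the target adapted to the range distribution\<close>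
  define l where "l = m - r"
  have D_subspace: "subspace (D p)" and D_dim: "dim (D p) = l" for p
    using assms(8) by (auto simp: range_distribution_def smooth_distribution_def l_def)
  have l_le: "l \<le> DIM('f)"
    using D_dim[of q] dim_subset_UNIV[of "D q"] by simp
  \<comment> \<open>Shifting the indices by \<open>r\<close> makes the frame of \<open>D\<close> an
    initial part of a frame indexed by \<open>{1..DIM('f)}\<close>, the index set used by
    \<open>ricci_soliton\<close>.\<close>
  have bij: "bij_betw (\<lambda>i. r + i) {1..l} {r+1..m}"
    by (rule bij_betwI[of _ _ _ "\<lambda>j. j - r"]) (auto simp: l_def)
  have image: "(\<lambda>i. r + i) ` {1..l} = {r+1..m}" using bij by (simp add: bij_betw_def)
  have idx: "r + i \<in> {r+1..m}" if "i \<in> {1..l}" for i using that by (auto simp: l_def)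
  have E_on: "N.orthonormal p {1..l} (\<lambda>i. E (r + i) p)" if "p \<in> W" for p
    unfolding N.orthonormal_def
    using frame that idx by (auto simp: local_orthonormal_frame_def)
  have "\<exists>V E'. open V \<and> q \<in> V \<and> V \<subseteq> W \<and> (\<forall>i\<in>{1..l}. E' i = E (r + i)) \<and>
    (\<forall>i\<in>{1..DIM('f)}. smooth_field_on N V (E' i)) \<and>
    (\<forall>p\<in>V. N.orthonormal p {1..DIM('f)} (\<lambda>i. E' i p))"
    by (rule N.extend_orthonormal_frame[of l W q "\<lambda>i. E (r + i)"])
      (use frame qW idx E_on l_le in \<open>auto simp: local_orthonormal_frame_def section_on_def\<close>)
  then obtain V e where V: "open V" "q \<in> V" "V \<subseteq> W" and eE: "\<And>i. i \<in> {1..l} \<Longrightarrow> e i = E (r + i)"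
    and e_smooth: "\<And>i. i \<in> {1..DIM('f)} \<Longrightarrow> smooth_field_on N V (e i)"
    and e_on: "\<And>p. p \<in> V \<Longrightarrow> N.orthonormal p {1..DIM('f)} (\<lambda>i. e i p)"
    by blast
  interpret N: orthonormal_frame N gN nabN V "{1..DIM('f)}" e
    using V(1) e_smooth e_on by unfold_locales auto
  define K J where "K = {1..l}" and "J = {l+1..DIM('f)}"
  have IKJ: "{1..DIM('f)} = K \<union> J" "K \<inter> J = {}" using l_le by (auto simp: K_def J_def)
  have e_smooth_K: "smooth_field_on N V (e i)" if "i \<in> K" for i
    by (rule e_smooth) (use that IKJ in blast)
  have e_smooth_J: "smooth_field_on N V (e i)" if "i \<in> J" for i
    by (rule e_smooth) (use that IKJ in blast)
  have D_span: "D p = span ((\<lambda>i. e i p) ` K)" if "p \<in> V" for p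
  proof -
    have "D p = span ((\<lambda>j. E j p) ` {r+1..m})"
      using frame that V by (auto simp: local_orthonormal_frame_def)
    also have "(\<lambda>j. E j p) ` {r+1..m} = (\<lambda>i. e i p) ` K"
      unfolding image[symmetric] image_image K_def by (intro image_cong) (simp_all add: eE)
    finally show ?thesis .
  qed
  have e_D: "e i p \<in> D p" if "p \<in> V" "i \<in> K" for i p
    using that by (auto simp: D_span intro: span_base)
  have e_perp: "gN p v (e j p) = 0" if "p \<in> V" "j \<in> J" "v \<in> D p" for j p v
    using that(3) unfolding D_span[OF that(1)]
  proof (induction rule: span_induct)
    case base
    then show ?case by (auto simp: subspace_def N.metric_bilinear_simps)
  next
    case (step x)
    then obtain i where "i \<in> K" "x = e i p" by auto
    moreover from this have "i \<noteq> j" using that IKJ by auto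
    ultimately show ?case using e_on[OF that(1)] that IKJ unfolding N.orthonormal_def by auto
  qed
  have e_compl: "e j p \<in> orth_compl gN D p" if "p \<in> V" "j \<in> J" for j p
    using e_perp[OF that] N.metric_sym[of p "e j p"] by (auto simp: orth_compl_def)

  \<comment> \<open>Parallelism of the range distribution\<close>
  have skew: "gN p (nabN (e a) (e k) p) (e j p) = - gN p (e k p) (nabN (e a) (e j) p)"
    if "p \<in> V" "a \<in> {1..DIM('f)}" "k \<in> K" "j \<in> J" for p a k j
    using that e_perp[OF _ that(4) e_D[OF _ that(3)]]
    by (intro N.nab_skew[OF V(1)] e_smooth[OF that(2)] e_smooth_K e_smooth_J)
  have parallel: "gN p (nabN (e a) (e k) p) (e j p) = 0"
    if p: "p \<in> V" and a: "a \<in> {1..DIM('f)}" and k: "k \<in> K" and j: "j \<in> J" for p a k j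
  proof (cases "a \<in> J")
    case True
    \<comment> \<open>For directions in the complement, \<open>e a\<close> and \<open>e j\<close>
      are both sections of it, and its being totally geodesic controls the derivative of
      \<open>e j\<close>.\<close>
    have "section_on N (orth_compl gN D) V (e i)" if "i \<in> J" for i
      using that e_compl e_smooth_J by (auto simp: section_on_def)
    then have "nabN (e a) (e j) p \<in> orth_compl gN D p"
      using assms(11) V(1) True j p unfolding totally_geodesic_distribution_at_def by blast
    then have "gN p (e k p) (nabN (e a) (e j) p) = 0"
      using e_D[OF p k] N.metric_sym by (auto simp: orth_compl_def)
    then show ?thesis using skew[OF p a k j] by simp
  next
    case False
    then have aK: "a \<in> K" using a IKJ by auto
    have sm: "smooth_field_on N V (e a)" "smooth_field_on N V (e k)" "smooth_field_on N V (e j)"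
      by (intro e_smooth_K e_smooth_J aK k j)+
    \<comment> \<open>The quantity to be shown zero, as a function of the point: it vanishes on the
      image of \<open>F\<close>, and continuity carries this to the closure.\<close>
    define G where "G y = gN y (nabN (e a) (e k) y) (e j y)" for y
    have G_range: "G (F x) = 0" if x: "F x \<in> V" for x
    proof -
      obtain v w where v: "e k (F x) = pushforward M N F x v" and w: "e a (F x) = pushforward M N F x w"
        using e_D[OF x k] e_D[OF x aK] assms(8) unfolding range_distribution_def by auto
      let ?C = "coord_field N (F x) (pushforward M N F x w)" and ?U = "V \<inter> chart_dom N (F x)"
      \<comment> \<open>Only the value of the direction field at \<open>F x\<close> matters, so
        \<open>e a\<close> may be replaced by the coordinate field that occurs in
        \<open>totally_geodesic_map_normal\<close>.\<close>
      have "nabN (e a) (e j) (F x) = nabN ?C (e j) (F x)"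
        using V x sm w
        by (intro N.nab_pointwise_left[of ?U])
          (auto intro: N.smooth_field_on_subset N.smooth_field_on_subset[OF N.smooth_field_on_coord_field])
      moreover have "gN (F x) (pushforward M N F x v) (nabN ?C (e j) (F x)) = 0"
        using e_perp[OF _ j] assms(8)
        by (intro totally_geodesic_map_normal[OF V(1) x sm(3) _ assms(9)])
          (auto simp: range_distribution_def)
      ultimately show ?thesis using skew[OF x a k j] v by (simp add: G_def)
    qed
    have G_cont: "continuous_on V G"
      unfolding G_def
      by (intro N.smooth_fun_on_continuous N.smooth_fun_on_metric N.smooth_field_on_nab V sm)
    have "G p = 0"
    proof (cases "p \<in> closure (range F)")
      case True
      show ?thesis
      proof (rule ccontr)
        assume "G p \<noteq> 0"
        \<comment> \<open>A nonzero value of \<open>G\<close> would persist on an open neighbourhood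
          of \<open>p\<close>, which meets the image of \<open>F\<close> because \<open>p\<close> is
          in its closure.\<close>
        have "open (V \<inter> G -` (- {0}))"
          by (intro continuous_open_preimage G_cont V) auto
        moreover have "p \<in> V \<inter> G -` (- {0})" using p \<open>G p \<noteq> 0\<close> by simp
        ultimately have "(V \<inter> G -` (- {0})) \<inter> range F \<noteq> {}"
          using True open_Int_closure_eq_empty by blast
        then show False using G_range by auto
      qed
    next
      case False
      have "section_on N D V (e i)" if "i \<in> K" for i
        using that e_D e_smooth_K by (auto simp: section_on_def)
      then have "nabN (e a) (e k) p \<in> D p"
        using assms(10) V(1) aK k p False unfolding totally_geodesic_distribution_at_def by blast
      then show ?thesis using e_perp[OF p j] by (simp add: G_def)
    qed
    then show ?thesis by (simp add: G_def)
  qed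
  interpret N: split_orthonormal_frame N gN nabN V "{1..DIM('f)}" e K J
    using IKJ parallel by unfold_locales auto

  \<comment> \<open>The soliton equation along the range distribution\<close>
  have xi: "smooth_field_on N V xi"
    using assms(13) N.smooth_field_on_subset unfolding section_on_def by blast
  have xi_perp: "gN p (xi p) (e i p) = 0" if "p \<in> V" "i \<in> K" for p i
    using assms(13) e_D[OF that] by (auto simp: section_on_def orth_compl_def)
  have full_frame: "local_orthonormal_frame N gN (\<lambda>_. UNIV) V {1..DIM('f)} e"
    using V(1) e_smooth e_on N.orthonormal_span_eq_UNIV[OF _ e_on]
    by (auto simp: local_orthonormal_frame_def section_on_def N.orthonormal_def)
  have soliton: "1/2 * lie_deriv_metric N gN xi (e k) (e k) q +
      (\<Sum>i\<in>{1..DIM('f)}. gN q (curvature N nabN (e i) (e k) (e k) q) (e i q)) + lam = 0"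
    if k: "k \<in> K" for k
  proof -
    have kI: "k \<in> {1..DIM('f)}" using k IKJ by auto
    have "1/2 * lie_deriv_metric N gN xi (e k) (e k) q + ric N gN nabN {1..DIM('f)} e (e k) (e k) q
        + lam * gN q (e k q) (e k q) = 0"
      using assms(12) full_frame e_smooth[OF kI] V(2) unfolding ricci_soliton_def by blast
    moreover have "gN q (e k q) (e k q) = 1"
      using e_on[OF V(2)] kI by (simp add: N.orthonormal_def)
    ultimately show ?thesis by (simp add: ric_def)
  qed
  \<comment> \<open>Since \<open>e i\<close> and \<open>E (r + i)\<close> are equal as functions,
    the curvature terms agree and only the summation index is shifted.\<close>
  have "scalar_curv N gN nabN {r+1..m} E q =
      (\<Sum>k\<in>K. \<Sum>i\<in>K. gN q (curvature N nabN (e i) (e k) (e k) q) (e i q))"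
    unfolding scalar_curv_def ric_def K_def sum.reindex_bij_betw[OF bij, symmetric]
    by (intro sum.cong) (simp_all add: eE)
  also have "\<dots> = - lam * real (card K)"
    by (rule N.scalar_curv_K[OF V(2) xi xi_perp soliton])
  finally show "scalar_curv N gN nabN {r+1..m} E q = - lam * real (m - r)"
    by (simp add: K_def l_def)
qed

end
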